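(* Let $n\ge 2$ and let $w$ be an element of the affine symmetric group $\tilde S_n$. Then the affine Schubert polynomial $\tilde{\mathfrak S}_w$ is monomial-positive: it is a linear combination with nonnegative integer coefficients of products $m_\lambda\,x_1^{a_1}\cdots x_n^{a_n}$, where $m_\lambda$ are monomial symmetric functions.
   Context: Let $G=\mathrm{SL}(n)$, with affine Weyl group $\tilde S_n$ (simple reflections $s_0,\dots,s_{n-1}$) and finite Weyl group $S_n$. Let $\Lambda$ be the ring of symmetric functions and $I_n=\langle m_\lambda:\lambda_1\ge n\rangle$. There are isomorphisms $H^*(\mathrm{Gr}_G)\cong\Lambda/I_n$ and $H^*(G/B)\cong\mathbb Z[x_1,\dots,x_n]/\langle e_j(x_1,\dots,x_n):j\ge1\rangle$, giving $H^*(\hat{\mathrm{Fl}}_G)\cong\Lambda/I_n\otimes_{\mathbb Z}\mathbb Z[x_1,\dots,x_n]/\langle e_j(x_1,\dots,x_n):j\ge1\rangle$. The affine Schubert polynomial $\tilde{\mathfrak S}_w$ (of S. Lee) is a polynomial representative, in $\Lambda\otimes\mathbb Z[x_1,\dots,x_n]$, of the Schubert class $\xi^w\in H^*(\hat{\mathrm{Fl}}_G)$ under this isomorphism; it equals $\sum_{w\doteq uv,\ u\in\tilde S_n,\ v\in S_n}F_u\,\mathfrak S_v(x)$, where $F_u$ is the affine Stanley symmetric function, $\mathfrak S_v$ the Schubert polynomial, and $w\doteq uv$ means $w=uv$ with $\ell(w)=\ell(u)+\ell(v)$. *)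

theory Defs
  imports Main "HOL-Library.Poly_Mapping" "HOL-Library.Multiset"
begin

definition affine_perm :: "nat \<Rightarrow> (int \<Rightarrow> int) \<Rightarrow> bool" where
  "affine_perm n w \<longleftrightarrow> bij w \<and> (\<forall>i. w (i + int n) = w i + int n) \<and>
     (\<Sum>i\<in>{1..int n}. w i) = int n * (int n + 1) div 2"

definition sref :: "nat \<Rightarrow> nat \<Rightarrow> int \<Rightarrow> int" where
  "sref n k i = (if i mod int n = int k then i + 1
                 else if i mod int n = (int k + 1) mod int n then i - 1 else i)"

definition word_prod :: "nat \<Rightarrow> nat list \<Rightarrow> int \<Rightarrow> int" where
  "word_prod n ws = foldr (\<lambda>k f. sref n k \<circ> f) ws id"

definition alen :: "nat \<Rightarrow> (int \<Rightarrow> int) \<Rightarrow> nat" where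
  "alen n w = (LEAST k. \<exists>ws. set ws \<subseteq> {0..<n} \<and> length ws = k \<and> word_prod n ws = w)"

definition fin_perm :: "nat \<Rightarrow> (int \<Rightarrow> int) \<Rightarrow> bool" where
  "fin_perm n v \<longleftrightarrow> affine_perm n v \<and> v ` {1..int n} = {1..int n}"

definition cyc_dec :: "nat \<Rightarrow> (int \<Rightarrow> int) \<Rightarrow> bool" where
  "cyc_dec n v \<longleftrightarrow> (\<exists>ws. set ws \<subseteq> {0..<n} \<and> distinct ws \<and> word_prod n ws = v \<and>
      length ws = alen n v \<and>
      (\<forall>p q. p < length ws \<longrightarrow> q < length ws \<longrightarrow> ws ! q = (ws ! p + 1) mod n \<longrightarrow> q < p))"

text \<open>Symmetric functions in variables y_0, y_1, ... are represented by their coefficient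
  functions on monomials alpha (finitely supported exponent vectors).
  [y^alpha] F_u = number of length-additive factorizations u = v^0 v^1 ... v^(N-1)
  into cyclically decreasing elements with l(v^i) = alpha_i.\<close>
definition ybound :: "(nat \<Rightarrow>\<^sub>0 nat) \<Rightarrow> nat" where
  "ybound \<alpha> = (if Poly_Mapping.keys \<alpha> = {} then 0 else Suc (Max (Poly_Mapping.keys \<alpha>)))"

definition affine_stanley_coeff :: "nat \<Rightarrow> (int \<Rightarrow> int) \<Rightarrow> (nat \<Rightarrow>\<^sub>0 nat) \<Rightarrow> nat" where
  "affine_stanley_coeff n u \<alpha> = card {vs. length vs = ybound \<alpha> \<and>
      (\<forall>i < ybound \<alpha>. cyc_dec n (vs ! i) \<and> alen n (vs ! i) = Poly_Mapping.lookup \<alpha> i) \<and>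
      foldr (\<circ>) vs id = u \<and> alen n u = (\<Sum>i<ybound \<alpha>. Poly_Mapping.lookup \<alpha> i)}"

type_synonym mpoly = "(nat \<Rightarrow>\<^sub>0 nat) \<Rightarrow>\<^sub>0 int"

definition Xvar :: "nat \<Rightarrow> mpoly" where
  "Xvar i = Poly_Mapping.single (Poly_Mapping.single i 1) 1"

definition swapnat :: "nat \<Rightarrow> nat \<Rightarrow> nat" where
  "swapnat i k = (if k = i then i + 1 else if k = i + 1 then i else k)"

definition swapv :: "nat \<Rightarrow> mpoly \<Rightarrow> mpoly" where
  "swapv i p = Poly_Mapping.map_key (Poly_Mapping.map_key (swapnat i)) p"

definition ddiff :: "nat \<Rightarrow> mpoly \<Rightarrow> mpoly" where
  "ddiff i f = (THE g. (Xvar i - Xvar (i + 1)) * g = f - swapv i f)"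

definition w0 :: "nat \<Rightarrow> int \<Rightarrow> int" where
  "w0 n i = ((i - 1) div int n) * int n + int n - (i - 1) mod int n"

definition schub_top :: "nat \<Rightarrow> mpoly" where
  "schub_top n = (\<Prod>i\<in>{1..<n}. Xvar i ^ (n - i))"

definition schub :: "nat \<Rightarrow> (int \<Rightarrow> int) \<Rightarrow> mpoly" where
  "schub n v = (SOME p. \<exists>ws. set ws \<subseteq> {1..<n} \<and> word_prod n ws = w0 n \<circ> v \<and>
       length ws = alen n (w0 n \<circ> v) \<and> p = fold ddiff ws (schub_top n))"

definition aff_schub_coeff :: "nat \<Rightarrow> (int \<Rightarrow> int) \<Rightarrow> (nat \<Rightarrow>\<^sub>0 nat) \<Rightarrow> (nat \<Rightarrow>\<^sub>0 nat) \<Rightarrow> int" where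
  "aff_schub_coeff n w \<alpha> a = (\<Sum>(u, v)\<in>{(u, v). affine_perm n u \<and> fin_perm n v \<and> w = u \<circ> v \<and>
        alen n w = alen n u + alen n v}.
      int (affine_stanley_coeff n u \<alpha>) * Poly_Mapping.lookup (schub n v) a)"

definition is_partition :: "nat list \<Rightarrow> bool" where
  "is_partition lam \<longleftrightarrow> sorted_wrt (\<ge>) lam \<and> (\<forall>x\<in>set lam. 0 < x)"

definition mono_sym :: "nat list \<Rightarrow> (nat \<Rightarrow>\<^sub>0 nat) \<Rightarrow> int" where
  "mono_sym lam \<alpha> = (if is_partition lam \<and> mset lam = image_mset (Poly_Mapping.lookup \<alpha>) (mset_set (Poly_Mapping.keys \<alpha>))
                    then 1 else 0)"

end

theory Submission
  imports Defs "HOL-Library.FuncSet" "HOL-Computational_Algebra.Polynomial"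
begin

text \<open>
  Let hop i x = 1 + x u_i, where u_i is the i-th generator of the nilCoxeter algebra acting on
  functions of integer sequences. These operators satisfy the Yang-Baxter equation, and both halves
  of the theorem follow from it.

  Positivity of Schubert polynomials (after Fomin and Stanley): the coefficient of v in the staircase
  product of the operators hop i X_j is visibly a polynomial with nonnegative coefficients, and the
  Yang-Baxter equation shows that divided differences act on it as they do on Schubert polynomials.

  Symmetry of affine Stanley functions: multiplying w by a cyclically decreasing element cuts the
  sequence w into periodic blocks, each ending in its maximum, and moves each maximum to the front of
  its block. Read from right to left, this is one carrier travelling through the sequence with
  an operator hop i x at each site, so the generating function of products of two such elements is a
  trace over the pair of carriers, twisted by the shift by n. The Yang-Baxter equation conjugates the
  two orders of the parameters x and y into one another, and the trace is invariant.
\<close>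

section \<open>Length of affine permutations\<close>

text \<open>Each coefficient of an affine Stanley function is a cardinality, so its sign is never in
  doubt. What has to be proved is symmetry: only then can the coefficient of the monomial symmetric
  function of a partition be read off at any exponent vector with these nonzero entries. The
  definition of \<open>schub\<close> selects an unspecified reduced word, so positivity is proved
  for the outcome of every word. In the affine half the obstacle is that a product of operators
  around a circle has no first site. The circle is cut open, the value entering at the cut becomes a
  variable, and the requirement that it return shifted by one period turns the sum over this value
  into the twisted trace. For this the operators must act on arbitrary integer sequences, not only
  on permutations, since a carrier is an arbitrary entry. The coefficient ring is arbitrary as well:
  polynomials in the finite variables in one half, an integral domain holding the parameters
  \<open>x\<close> and \<open>y\<close> in the other.\<close>

lemma sum_periodic_window:
  fixes f :: "int \<Rightarrow> 'a::ab_group_add"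
  assumes per: "\<And>i. f (i + int n) = f i"
  shows "sum f {a..<a + int n} = sum f {b..<b + int n}"
proof -
  have step: "sum f {c..<c + int n} = sum f {c + 1..<c + 1 + int n}" for c
  proof (cases "n = 0")
    case False
    have "{c..<c + int n} = insert c {c + 1..<c + int n}"
      "{c + 1..<c + 1 + int n} = insert (c + int n) {c + 1..<c + int n}"
      using False by auto
    then show ?thesis by (simp add: per)
  qed simp
  have up: "sum f {c..<c + int n} = sum f {c + int m..<c + int m + int n}" for c m
  proof (induction m)
    case (Suc m)
    then show ?case using step [of "c + int m"] by (simp add: ac_simps)
  qed simp
  show ?thesis
  proof (cases "a \<le> b")
    case True
    then show ?thesis using up [of a "nat (b - a)"] by simp
  next
    case False
    then show ?thesis using up [of b "nat (a - b)"] by simp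
  qed
qed

definition shift_equivariant :: "nat \<Rightarrow> (int \<Rightarrow> int) \<Rightarrow> bool" where
  "shift_equivariant n w \<longleftrightarrow> (\<forall>i. w (i + int n) = w i + int n)"

lemma shift_equivariantD: "shift_equivariant n w \<Longrightarrow> w (i + int n) = w i + int n"
  by (simp add: shift_equivariant_def)

lemma periodic_mult:
  fixes w :: "int \<Rightarrow> int"
  assumes per: "shift_equivariant n w"
  shows "w (i + int n * q) = w i + int n * q"
proof -
  have up: "w (j + int n * int m) = w j + int n * int m" for j m
  proof (induction m)
    case (Suc m)
    then show ?case using shift_equivariantD [OF per, of "j + int n * int m"] by (simp add: algebra_simps)
  qed simp
  show ?thesis
  proof (cases "q \<ge> 0")
    case True
    then show ?thesis using up [of i "nat q"] by simp
  next
    case False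
    then show ?thesis using up [of "i + int n * q" "nat (- q)"] by simp
  qed
qed

definition later_smaller :: "(int \<Rightarrow> int) \<Rightarrow> int \<Rightarrow> int set" where
  "later_smaller w i = {j. i < j \<and> w j < w i}"

text \<open>Inversions counted up to a simultaneous shift of both positions by \<open>n\<close>: the
  classical formula for the Coxeter length of an affine permutation. It replaces the minimum over
  all words in \<open>alen\<close>, see \<open>alen_eq_ainv\<close>.\<close>

definition ainv :: "nat \<Rightarrow> (int \<Rightarrow> int) \<Rightarrow> nat" where
  "ainv n w = (\<Sum>i\<in>{0..<int n}. card (later_smaller w i))"

lemma periodic_reduce:
  fixes w :: "int \<Rightarrow> int"
  assumes per: "shift_equivariant n w"
  shows "w i - i = w (i mod int n) - i mod int n"
  using periodic_mult [OF per, of "i mod int n" "i div int n"]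
  by (simp add: algebra_simps)

text \<open>\<open>w j - j\<close> depends only on the residue of \<open>j\<close>, so it is bounded
  below, and \<open>w j < w i\<close> bounds \<open>j\<close> from above.\<close>

lemma finite_later_smaller:
  fixes w :: "int \<Rightarrow> int"
  assumes n: "n > 0" and per: "shift_equivariant n w"
  shows "finite (later_smaller w i)"
proof -
  let ?D = "(\<lambda>r. w r - r) ` {0..<int n}"
  have ge: "w j - j \<ge> Min ?D" for j
    unfolding periodic_reduce [OF per, of j] using n
    by (intro Min_le) (auto intro!: image_eqI [where x = "j mod int n"])
  have "later_smaller w i \<subseteq> {i..w i - Min ?D}"
    unfolding later_smaller_def using ge by (auto simp: algebra_simps) (smt (verit))
  then show ?thesis by (rule finite_subset) simp
qed

lemma later_smaller_periodic:
  fixes w :: "int \<Rightarrow> int"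
  assumes per: "shift_equivariant n w"
  shows "card (later_smaller w (i + int n)) = card (later_smaller w i)"
proof (rule bij_betw_same_card [where f = "\<lambda>j. j - int n"])
  have *: "w (j - int n) = w j - int n" for j
    using shift_equivariantD [OF per, of "j - int n"] by simp
  show "bij_betw (\<lambda>j. j - int n) (later_smaller w (i + int n)) (later_smaller w i)"
    by (rule bij_betwI [where g = "\<lambda>j. j + int n"]) (auto simp: later_smaller_def shift_equivariantD [OF per] *)
qed

text \<open>A window starting at \<open>k\<close> holds the neighbours \<open>k\<close> and
  \<open>k + 1\<close> even for \<open>k = n - 1\<close>, where the standard period would separate
  them.\<close>

lemma ainv_window:
  fixes w :: "int \<Rightarrow> int"
  assumes per: "shift_equivariant n w"
  shows "int (ainv n w) = (\<Sum>i\<in>{a..<a + int n}. int (card (later_smaller w i)))"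
  unfolding ainv_def
  using sum_periodic_window [of "\<lambda>i. int (card (later_smaller w i))" n 0 a]
  by (simp add: later_smaller_periodic [OF per])

context
  fixes n :: nat
  assumes n2: "n \<ge> 2"
begin

lemma sref_add_period: "sref n k (i + int n) = sref n k i + int n"
  by (simp add: sref_def)

lemma mod_Suc_cases:
  assumes "k < n"
  shows "(i + 1) mod int n = (int k + 1) mod int n \<longleftrightarrow> i mod int n = int k"
proof -
  have "(i + 1) mod int n = (int k + 1) mod int n \<longleftrightarrow> i mod int n = int k mod int n"
    unfolding mod_eq_dvd_iff by simp
  then show ?thesis using assms by simp
qed

lemma sref_eq:
  assumes "k < n"
  shows "sref n k i = (if i mod int n = int k then i + 1 else if (i - 1) mod int n = int k then i - 1 else i)"
  using mod_Suc_cases [OF assms, of "i - 1"] by (simp add: sref_def)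

lemma mod_ne_succ: "(i + 1) mod int n \<noteq> i mod int n"
proof
  assume "(i + 1) mod int n = i mod int n"
  then have "int n dvd (i + 1) - i" by (metis mod_eq_dvd_iff)
  then show False using n2 by simp
qed

lemma sref_invol: "k < n \<Longrightarrow> sref n k (sref n k i) = i"
  using mod_ne_succ [of i] mod_ne_succ [of "i - 1"] by (auto simp: sref_eq)

lemma sref_comp_sref: "k < n \<Longrightarrow> sref n k \<circ> sref n k = id"
  by (auto simp: sref_invol fun_eq_iff)

lemma bij_sref: "k < n \<Longrightarrow> bij (sref n k)"
  by (rule o_bij [of "sref n k"]) (simp_all add: sref_comp_sref)

lemma sref_self: "k < n \<Longrightarrow> sref n k (int k) = int k + 1"
  by (simp add: sref_eq)

lemma sref_self_Suc: "k < n \<Longrightarrow> sref n k (int k + 1) = int k"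
  using mod_ne_succ [of "int k"] by (simp add: sref_eq)

lemma sref_in_window:
  assumes "k < n" "i \<in> {int k + 2..<int k + int n}"
  shows "sref n k i = i"
proof -
  have "i mod int n \<noteq> int k" if "int k < i" "i < int k + int n" for i
  proof
    assume "i mod int n = int k"
    then have "i mod int n = int k mod int n" using assms(1) by simp
    then have "int n dvd i - int k" by (metis mod_eq_dvd_iff)
    moreover have "0 < i - int k" "i - int k < int n" using that by auto
    ultimately show False using zdvd_not_zless by blast
  qed
  then show ?thesis using assms by (simp add: sref_eq)
qed

lemma window_split: "{int k..<int k + int n} = insert (int k) (insert (int k + 1) {int k + 2..<int k + int n})"
  using n2 by auto

text \<open>The reflection exchanges neighbours only, so it maps the half-line beyond
  \<open>i\<close> to itself unless \<open>i\<close> is the left member of an exchanged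
  pair.\<close>

lemma sref_less_iff:
  assumes "k < n" "i mod int n \<noteq> int k"
  shows "i < sref n k j \<longleftrightarrow> i < j"
proof (cases "j = i")
  case True
  with assms show ?thesis by (auto simp: sref_eq)
next
  case False
  moreover have "i \<noteq> j - 1 \<or> sref n k j \<noteq> j - 1" using assms by (auto simp: sref_eq)
  moreover have "sref n k j \<in> {j - 1, j, j + 1}" using assms by (simp add: sref_eq)
  ultimately show ?thesis
    by auto
qed

text \<open>Half-lines are permuted, so the counts outside the classes of \<open>k\<close> and
  \<open>k + 1\<close> survive. The counts at \<open>k\<close> and \<open>k + 1\<close> trade
  places, and the new inversion between these two positions adds the one.\<close>

lemma ainv_sref_up:
  assumes k: "k < n" and per: "shift_equivariant n w" and up: "w (int k) < w (int k + 1)"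
  shows "ainv n (w \<circ> sref n k) = ainv n w + 1"
proof -
  let ?s = "sref n k" and ?K = "int k"
  let ?c = "\<lambda>w i. int (card (later_smaller w i))"
  have per': "shift_equivariant n (w \<circ> ?s)"
    using per by (simp add: shift_equivariant_def sref_add_period)
  have im: "card {j. i < j \<and> w (?s j) < c} = card {j. i < j \<and> w j < c}" if "i mod int n \<noteq> ?K" for i c
    by (rule bij_betw_same_card [of ?s], rule bij_betwI [where g = ?s])
      (auto simp: sref_less_iff [OF k that] sref_invol [OF k])
  have rest: "?c (w \<circ> ?s) i = ?c w i" if "i \<in> {?K + 2..<?K + int n}" for i
  proof -
    have "i mod int n \<noteq> ?K"
      using sref_in_window [OF k that] by (auto simp: sref_eq [OF k] split: if_splits)
    then show ?thesis using im [of i "w i"] by (simp add: later_smaller_def sref_in_window [OF k that])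
  qed
  have m1: "(?K + 1) mod int n \<noteq> ?K" using mod_ne_succ [of ?K] k by simp
  have c1: "?c (w \<circ> ?s) (?K + 1) = ?c w ?K"
  proof -
    have "{j. ?K + 1 < j \<and> w j < w ?K} = later_smaller w ?K"
      using up by (auto simp: later_smaller_def) (smt (verit))
    then show ?thesis using im [OF m1, of "w ?K"] by (simp add: later_smaller_def sref_self_Suc [OF k])
  qed
  have c0: "?c (w \<circ> ?s) ?K = ?c w (?K + 1) + 1"
  proof -
    have eq: "later_smaller (w \<circ> ?s) ?K = insert (?K + 1) {j. ?K + 1 < j \<and> w (?s j) < w (?K + 1)}"
      using up by (auto simp: later_smaller_def sref_self [OF k] sref_self_Suc [OF k])
    have c: "card {j. ?K + 1 < j \<and> w (?s j) < w (?K + 1)} = card (later_smaller w (?K + 1))"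
      using im [OF m1, of "w (?K + 1)"] by (simp add: later_smaller_def)
    have "finite {j. ?K + 1 < j \<and> w (?s j) < w (?K + 1)}"
      by (rule finite_subset [OF _ finite_later_smaller [of n "w \<circ> ?s" ?K]])
        (use n2 eq per' in auto)
    then show ?thesis using eq c by simp
  qed
  have "int (ainv n (w \<circ> ?s)) = int (ainv n w) + 1"
    unfolding ainv_window [OF per, of ?K] ainv_window [OF per', of ?K] window_split
    by (simp add: c0 c1) (simp add: rest)
  then show ?thesis by linarith
qed

lemma affine_perm_period: "affine_perm n w \<Longrightarrow> w (i + int n) = w i + int n"
  by (simp add: affine_perm_def)

lemma affine_perm_equivariant: "affine_perm n w \<Longrightarrow> shift_equivariant n w"
  by (simp add: affine_perm_def shift_equivariant_def)

lemmas affine_perm_period_mult = periodic_mult [OF affine_perm_equivariant]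

lemma affine_perm_neq: "affine_perm n w \<Longrightarrow> i \<noteq> j \<Longrightarrow> w i \<noteq> w j"
  by (auto simp: affine_perm_def bij_def inj_def)

lemma gauss_int: "(\<Sum>i\<in>{1..int n}. i) = int n * (int n + 1) div 2"
proof -
  have "(\<Sum>i\<in>{1..int m}. i) = int m * (int m + 1) div 2" for m
  proof (induction m)
    case (Suc m)
    have "{1..int (Suc m)} = insert (int m + 1) {1..int m}" by auto
    then have "(\<Sum>i\<in>{1..int (Suc m)}. i) = (int m + 1) + int m * (int m + 1) div 2" using Suc by simp
    also have "\<dots> = ((int m + 1) * 2 + int m * (int m + 1)) div 2" by simp
    also have "\<dots> = int (Suc m) * (int (Suc m) + 1) div 2" by (simp add: algebra_simps)
    finally show ?case .
  qed simp
  then show ?thesis .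
qed

lemma affine_perm_iff:
  "affine_perm n w \<longleftrightarrow> bij w \<and> (\<forall>i. w (i + int n) = w i + int n) \<and> (\<Sum>i\<in>{a..<a + int n}. w i - i) = 0"
proof -
  have "(\<Sum>i\<in>{a..<a + int n}. w i - i) = (\<Sum>i\<in>{1..int n}. w i) - int n * (int n + 1) div 2"
    if "\<forall>i. w (i + int n) = w i + int n"
  proof -
    have "(\<Sum>i\<in>{a..<a + int n}. w i - i) = (\<Sum>i\<in>{1..<1 + int n}. w i - i)"
      by (rule sum_periodic_window) (simp add: that)
    also have "{1..<1 + int n} = {1..int n}" by auto
    finally show ?thesis by (simp add: sum_subtractf gauss_int)
  qed
  then show ?thesis by (auto simp: affine_perm_def)
qed

lemma affine_perm_id: "affine_perm n id"
  by (simp add: affine_perm_iff [of _ 0])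

lemma affine_perm_sref:
  assumes k: "k < n" and w: "affine_perm n w"
  shows "affine_perm n (w \<circ> sref n k)"
proof -
  have "(\<Sum>i\<in>{int k..<int k + int n}. w (sref n k i) - i) = (\<Sum>i\<in>{int k..<int k + int n}. w i - i)"
    unfolding window_split
    by (simp add: sref_self [OF k] sref_self_Suc [OF k]) (simp add: sref_in_window [OF k])
  then show ?thesis using w bij_sref [OF k] unfolding affine_perm_iff [of _ "int k"]
    by (simp add: sref_add_period bij_comp)
qed

section \<open>Words in the simple reflections and reduced words\<close>

lemma word_prod_Nil: "word_prod n [] = id"
  by (simp add: word_prod_def)

lemma word_prod_Cons: "word_prod n (k # ws) = sref n k \<circ> word_prod n ws"
  by (simp add: word_prod_def)

lemma word_prod_append: "word_prod n (xs @ ys) = word_prod n xs \<circ> word_prod n ys"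
  by (induction xs) (simp_all add: word_prod_Nil word_prod_Cons comp_assoc)

lemma word_prod_snoc: "word_prod n (xs @ [k]) = word_prod n xs \<circ> sref n k"
  by (simp add: word_prod_append word_prod_Cons word_prod_Nil)

lemma affine_perm_word_prod: "set ws \<subseteq> {0..<n} \<Longrightarrow> affine_perm n (word_prod n ws)"
  by (induction ws rule: rev_induct) (auto simp: word_prod_Nil affine_perm_id word_prod_snoc affine_perm_sref)

lemma ainv_sref_down:
  assumes k: "k < n" and w: "affine_perm n w" and down: "w (int k + 1) < w (int k)"
  shows "ainv n w = ainv n (w \<circ> sref n k) + 1"
proof -
  have "ainv n ((w \<circ> sref n k) \<circ> sref n k) = ainv n (w \<circ> sref n k) + 1"
    using down affine_perm_equivariant [OF affine_perm_sref [OF k w]]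
    by (intro ainv_sref_up k) (simp_all add: sref_self [OF k] sref_self_Suc [OF k])
  moreover have "(w \<circ> sref n k) \<circ> sref n k = w" by (simp add: comp_assoc sref_comp_sref [OF k])
  ultimately show ?thesis by simp
qed

lemma ainv_sref_le: "k < n \<Longrightarrow> affine_perm n w \<Longrightarrow> ainv n (w \<circ> sref n k) \<le> ainv n w + 1"
  using ainv_sref_up [of k w] ainv_sref_down [of k w] affine_perm_neq [of w "int k" "int k + 1"]
    affine_perm_equivariant [of w]
  by (cases "w (int k) < w (int k + 1)") (auto simp: linorder_neq_iff)

lemma ainv_comp_word_le:
  "set ws \<subseteq> {0..<n} \<Longrightarrow> affine_perm n w \<Longrightarrow> ainv n (w \<circ> word_prod n ws) \<le> ainv n w + length ws"
proof (induction ws arbitrary: w)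
  case (Cons k ws)
  then have k: "k < n" by simp
  have "ainv n ((w \<circ> sref n k) \<circ> word_prod n ws) \<le> ainv n (w \<circ> sref n k) + length ws"
    using Cons.prems by (intro Cons.IH affine_perm_sref [OF k]) simp_all
  then show ?case using ainv_sref_le [OF k Cons.prems(2)]
    by (simp add: word_prod_Cons comp_def)
qed (simp add: word_prod_Nil)

lemma ainv_id: "ainv n id = 0"
  by (simp add: ainv_def later_smaller_def)

lemma ainv_word_prod_le: "set ws \<subseteq> {0..<n} \<Longrightarrow> ainv n (word_prod n ws) \<le> length ws"
  using ainv_comp_word_le [of ws id] by (simp add: affine_perm_id ainv_id)

text \<open>Without descents \<open>w\<close> is strictly increasing, and
  \<open>w (i + n) = w i + n\<close> leaves no room for gaps, so \<open>w\<close> is a translation;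
  the normalized sum over a period makes it trivial.\<close>

lemma no_descent_imp_id:
  assumes w: "affine_perm n w" and asc: "\<And>k. k < n \<Longrightarrow> w (int k) < w (int k + 1)"
  shows "w = id"
proof -
  have up: "w i + 1 \<le> w (i + 1)" for i
  proof -
    have "w (int (nat (i mod int n))) < w (int (nat (i mod int n)) + 1)"
      using n2 by (intro asc) (simp add: nat_less_iff)
    then have "w (i mod int n) < w (i mod int n + 1)" using n2 by simp
    moreover have "w i = w (i mod int n) + int n * (i div int n)"
      using affine_perm_period_mult [OF w, of "i mod int n" "i div int n"] by simp
    moreover have "w (i + 1) = w (i mod int n + 1) + int n * (i div int n)"
      using affine_perm_period_mult [OF w, of "i mod int n + 1" "i div int n"]
      by (simp add: algebra_simps)
    ultimately show ?thesis by linarith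
  qed
  have upm: "w i + int m \<le> w (i + int m)" for i m
  proof (induction m)
    case (Suc m)
    then show ?case using up [of "i + int m"] by (simp add: ac_simps)
  qed simp
  have eq: "w (i + int m) = w i + int m" if "m \<le> n" for i m
    using upm [of i m] upm [of "i + int m" "n - m"] affine_perm_period [OF w, of i] that
    by (simp add: of_nat_diff)
  have eq0: "w i - i = w 0" if "i \<in> {0..<int n}" for i
    using eq [of "nat i" 0] that by (simp add: nat_le_iff)
  have "(\<Sum>i\<in>{0..<0 + int n}. w i - i) = 0" using w affine_perm_iff by blast
  moreover have "(\<Sum>i\<in>{0..<int n}. w i - i) = (\<Sum>i\<in>{0..<int n}. w 0)"
    by (rule sum.cong) (auto simp: eq0)
  ultimately have "w 0 = 0" using n2 by simp
  then have "w i - i = 0" for i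
    using periodic_reduce [OF affine_perm_equivariant [OF w], of i] eq0 [of "i mod int n"] n2
    by simp
  then show ?thesis by (auto simp: fun_eq_iff)
qed

lemma fin_perm_sref:
  assumes k: "k \<in> {1..<n}" and w: "fin_perm n w"
  shows "fin_perm n (w \<circ> sref n k)"
proof -
  have s: "sref n k ` {1..int n} \<subseteq> {1..int n}"
  proof
    fix j assume "j \<in> sref n k ` {1..int n}"
    then obtain i where i: "i \<in> {1..int n}" "j = sref n k i" by auto
    have "i mod int n = int k \<Longrightarrow> i < int n" using k i(1) by (cases "i = int n") auto
    moreover have "(i - 1) mod int n = int k \<Longrightarrow> i - 1 \<ge> 1" using k i(1) by (cases "i = 1") auto
    moreover have "j = (if i mod int n = int k then i + 1 else if (i - 1) mod int n = int k then i - 1 else i)"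
      using i(2) k by (simp only: sref_eq atLeastLessThan_iff)
    ultimately show "j \<in> {1..int n}" using i(1) by (simp split: if_splits)
  qed
  have "bij (sref n k)" using bij_sref k by simp
  then have "sref n k ` {1..int n} = {1..int n}"
    using s by (intro card_subset_eq) (auto simp: card_image bij_def inj_on_subset)
  then have "(w \<circ> sref n k) ` {1..int n} = w ` {1..int n}" by (metis image_comp)
  then show ?thesis using w k affine_perm_sref by (simp add: fin_perm_def)
qed

lemma fin_perm_ascent_0:
  assumes "fin_perm n w"
  shows "w 0 < w 1"
proof -
  have "w 0 = w (int n) - int n" using affine_perm_period [of w 0] assms by (simp add: fin_perm_def)
  moreover have "w (int n) \<in> {1..int n}" "w 1 \<in> {1..int n}"
    using assms n2 imageI [of "int n" "{1..int n}" w] imageI [of 1 "{1..int n}" w]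
    by (simp_all add: fin_perm_def)
  ultimately show ?thesis by auto
qed

text \<open>Descents are removed from the right, each lowering \<open>ainv\<close> by one. A finite
  permutation never descends at 0, so its word stays in \<open>{1..<n}\<close>, the alphabet
  prescribed by \<open>schub\<close>.\<close>

lemma ex_reduced_word:
  assumes "affine_perm n w"
  shows "\<exists>ws. set ws \<subseteq> {0..<n} \<and> length ws = ainv n w \<and> word_prod n ws = w \<and>
    (fin_perm n w \<longrightarrow> set ws \<subseteq> {1..<n})"
  using assms
proof (induction "ainv n w" arbitrary: w rule: less_induct)
  case less
  show ?case
  proof (cases "\<exists>k<n. w (int k + 1) < w (int k)")
    case True
    then obtain k where k: "k < n" and d: "w (int k + 1) < w (int k)" by blast
    let ?v = "w \<circ> sref n k"
    have len: "ainv n w = ainv n ?v + 1" by (rule ainv_sref_down [OF k less.prems d])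
    then obtain ws where ws: "set ws \<subseteq> {0..<n}" "length ws = ainv n ?v" "word_prod n ws = ?v"
        "fin_perm n ?v \<longrightarrow> set ws \<subseteq> {1..<n}"
      using less.hyps [of ?v] affine_perm_sref [OF k less.prems] by auto
    have "word_prod n (ws @ [k]) = w"
      by (simp add: word_prod_snoc ws comp_assoc sref_comp_sref [OF k])
    moreover have "k \<in> {1..<n}" if "fin_perm n w"
      using fin_perm_ascent_0 [OF that] d k by (cases "k = 0") auto
    ultimately show ?thesis using ws k len fin_perm_sref
      by (intro exI [of _ "ws @ [k]"]) auto
  next
    case False
    have "w (int k) < w (int k + 1)" if "k < n" for k
      using False that affine_perm_neq [OF less.prems, of "int k" "int k + 1"]
      by (auto simp: linorder_neq_iff)
    then have "w = id" by (rule no_descent_imp_id [OF less.prems])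
    then show ?thesis by (intro exI [of _ "[]"]) (simp add: ainv_id word_prod_Nil)
  qed
qed

lemma alen_eq_ainv:
  assumes "affine_perm n w"
  shows "alen n w = ainv n w"
  unfolding alen_def
  by (rule Least_equality) (use ex_reduced_word [OF assms] ainv_word_prod_le in blast)+

lemma affine_perm_comp:
  assumes "affine_perm n f" "affine_perm n g"
  shows "affine_perm n (f \<circ> g)"
proof -
  obtain xs ys where "set xs \<subseteq> {0..<n}" "word_prod n xs = f" "set ys \<subseteq> {0..<n}" "word_prod n ys = g"
    using ex_reduced_word assms by meson
  then show ?thesis using affine_perm_word_prod [of "xs @ ys"] by (auto simp: word_prod_append)
qed

lemma alen_comp_le:
  assumes "affine_perm n f" "affine_perm n g"
  shows "alen n (f \<circ> g) \<le> alen n f + alen n g"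
proof -
  obtain ys where "set ys \<subseteq> {0..<n}" "word_prod n ys = g" "length ys = ainv n g"
    using ex_reduced_word assms by meson
  then show ?thesis using ainv_comp_word_le [of ys f] assms
    by (auto simp: alen_eq_ainv affine_perm_comp)
qed

lemma alen_comp_word_le:
  assumes "affine_perm n w" "set ws \<subseteq> {0..<n}"
  shows "alen n (w \<circ> word_prod n ws) \<le> alen n w + length ws"
  using ainv_comp_word_le [of ws w] assms by (simp add: alen_eq_ainv affine_perm_comp affine_perm_word_prod)

lemma alen_sref:
  assumes k: "k < n" and w: "affine_perm n w"
  shows "alen n (w \<circ> sref n k) = (if w (int k) < w (int k + 1) then alen n w + 1 else alen n w - 1)"
proof -
  have "w (int k) \<noteq> w (int k + 1)" using affine_perm_neq [OF w] by simp
  then show ?thesis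
    using ainv_sref_up [OF k, of w] ainv_sref_down [OF k w] affine_perm_equivariant [OF w]
    by (auto simp: alen_eq_ainv w affine_perm_sref [OF k w])
qed

lemma alen_id: "alen n id = 0"
  by (simp add: alen_eq_ainv affine_perm_id ainv_id)

lemma alen_0_imp_id:
  assumes "affine_perm n w" "alen n w = 0"
  shows "w = id"
  using ex_reduced_word [OF assms(1)] assms by (auto simp: alen_eq_ainv word_prod_Nil)

end

section \<open>NilCoxeter operators and the Yang-Baxter equation\<close>

text \<open>Indexed by a set so that one definition serves a single transposition,
  \<open>K = {i}\<close>, and a periodic reflection, \<open>K\<close> a residue class. It is an
  involution when \<open>K\<close> contains no two consecutive integers.\<close>

definition swp :: "int set \<Rightarrow> int \<Rightarrow> int" where
  "swp K i = (if i \<in> K then i + 1 else if i - 1 \<in> K then i - 1 else i)"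

text \<open>Entries may repeat, and a tie is no ascent. This lets the operator act on sequences into
  which carriers have been written.\<close>

definition hop :: "int \<Rightarrow> 'a::comm_ring_1 \<Rightarrow> ((int \<Rightarrow> int) \<Rightarrow> 'a) \<Rightarrow> (int \<Rightarrow> int) \<Rightarrow> 'a" where
  "hop i x \<phi> w = \<phi> w + (if w i < w (i + 1) then x * \<phi> (w \<circ> swp {i}) else 0)"

text \<open>At an argument \<open>w\<close> the outermost factor acts first, so the sites are
  visited from \<open>i + m - 1\<close> down to \<open>i\<close>: the entry at \<open>i + m\<close>
  comes in as the carrier, and a carrier is left behind at \<open>i\<close>.\<close>

fun row :: "int \<Rightarrow> nat \<Rightarrow> 'a::comm_ring_1 \<Rightarrow> ((int \<Rightarrow> int) \<Rightarrow> 'a) \<Rightarrow> (int \<Rightarrow> int) \<Rightarrow> 'a" where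
  "row i 0 x \<phi> = \<phi>"
| "row i (Suc m) x \<phi> = hop (i + int m) x (row i m x \<phi>)"

lemma swp_singleton_invol: "w \<circ> swp {i} \<circ> swp {i} = w"
  by (auto simp: fun_eq_iff swp_def)

lemma swp_braid: "w \<circ> swp {i + 1} \<circ> swp {i} \<circ> swp {i + 1} = w \<circ> swp {i} \<circ> swp {i + 1} \<circ> swp {i}"
  by (auto simp: fun_eq_iff swp_def)

lemma swp_commute:
  assumes "j \<ge> i + 2"
  shows "w \<circ> swp {i} \<circ> swp {j} = w \<circ> swp {j} \<circ> swp {i}"
  using assms by (auto simp: fun_eq_iff swp_def)

lemma comp_swp_apply:
  "(w \<circ> swp {i}) i = w (i + 1)" "(w \<circ> swp {i}) (i + 1) = w i" "j \<noteq> i \<Longrightarrow> j \<noteq> i + 1 \<Longrightarrow> (w \<circ> swp {i}) j = w j"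
  by (auto simp: swp_def)

text \<open>Both sides see only the relative order of the values at \<open>i\<close>,
  \<open>i + 1\<close>, \<open>i + 2\<close>; the case split covers every weak order, and the braid
  relation identifies the longest words of swaps.\<close>

lemma hop_yang_baxter:
  "hop (i + 1) a (hop i (a + b) (hop (i + 1) b \<phi>)) = hop i b (hop (i + 1) (a + b) (hop i a \<phi>))"
proof
  fix w :: "int \<Rightarrow> int"
  let ?u = "swp {i}" and ?v = "swp {i + 1}"
  have ap: "(w' \<circ> ?u) i = w' (i + 1)" "(w' \<circ> ?u) (i + 1) = w' i" "(w' \<circ> ?u) (i + 2) = w' (i + 2)"
    "(w' \<circ> ?v) i = w' i" "(w' \<circ> ?v) (i + 1) = w' (i + 2)" "(w' \<circ> ?v) (i + 2) = w' (i + 1)" for w' :: "int \<Rightarrow> int"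
    by (auto simp: swp_def add.commute)
  have two: "i + 1 + 1 = i + 2" by simp
  have "w i < w (i + 1) \<or> w i = w (i + 1) \<or> w (i + 1) < w i"
    "w i < w (i + 2) \<or> w i = w (i + 2) \<or> w (i + 2) < w i"
    "w (i + 2) < w (i + 1) \<or> w (i + 2) = w (i + 1) \<or> w (i + 1) < w (i + 2)" by auto
  then show "hop (i + 1) a (hop i (a + b) (hop (i + 1) b \<phi>)) w = hop i b (hop (i + 1) (a + b) (hop i a \<phi>)) w"
    unfolding hop_def ap two swp_braid swp_singleton_invol
    by (elim disjE) (simp_all add: algebra_simps)
qed

lemma hop_commute:
  assumes "j \<ge> i + 2"
  shows "hop j y (hop i x \<phi>) = hop i x (hop j y \<phi>)"
proof
  fix w :: "int \<Rightarrow> int"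
  have "(w \<circ> swp {j}) i = w i" "(w \<circ> swp {j}) (i + 1) = w (i + 1)"
    "(w \<circ> swp {i}) j = w j" "(w \<circ> swp {i}) (j + 1) = w (j + 1)" 
    using assms by (auto simp: swp_def)
  then show "hop j y (hop i x \<phi>) w = hop i x (hop j y \<phi>) w"
    unfolding hop_def swp_commute [OF assms] by (simp add: algebra_simps)
qed

lemma hop_add: "hop i x (hop i y \<phi>) = hop i (x + y) \<phi>"
  by (rule ext, unfold hop_def swp_singleton_invol comp_swp_apply) (simp add: algebra_simps)

lemma hop_row_commute:
  assumes "j \<ge> i + int m + 1"
  shows "hop j y (row i m x \<phi>) = row i m x (hop j y \<phi>)"
  using assms
proof (induction m)
  case (Suc m)
  then show ?case using hop_commute [of "i + int m" j y x "row i m x \<phi>"] by simp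
qed simp

lemma row_hop_commute:
  assumes "j + 2 \<le> i"
  shows "row i m x (hop j y \<phi>) = hop j y (row i m x \<phi>)"
  using assms
proof (induction m)
  case (Suc m)
  then show ?case using hop_commute [of j "i + int m" x y "row i m x \<phi>"] by simp
qed simp

text \<open>The factor with parameter \<open>x - y\<close> crosses the two staggered rows one step
  at a time by Yang-Baxter, exchanging the parameters as it passes; it enters at site
  \<open>i + m\<close> and leaves at \<open>i\<close>.\<close>

lemma row_exchange:
  "hop (i + int m) (x - y) (row i m x (row (i + 1) m y \<phi>)) =
   row i m y (row (i + 1) m x (hop i (x - y) \<phi>))"
proof (induction m)
  case (Suc m)
  let ?k = "i + int m"
  have sw: "row i m a (hop (?k + 1) b \<psi>) = hop (?k + 1) b (row i m a \<psi>)" for a b \<psi>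
    by (rule hop_row_commute [symmetric]) simp
  have k: "i + int (Suc m) = ?k + 1" "i + 1 + int m = ?k + 1" by simp_all
  \<comment> \<open>Yang-Baxter with parameters \<open>x - y\<close> and \<open>y\<close>, whose sum
    is \<open>x\<close>.\<close>
  have "hop (?k + 1) (x - y) (hop ?k ((x - y) + y) (hop (?k + 1) y (row i m x (row (i + 1) m y \<phi>)))) =
    hop ?k y (hop (?k + 1) ((x - y) + y) (hop ?k (x - y) (row i m x (row (i + 1) m y \<phi>))))"
    by (rule hop_yang_baxter)
  then show ?case
    unfolding row.simps k sw Suc.IH by simp
qed simp

lemma hop_cong:
  assumes "\<And>g g'. (\<And>k. k \<in> S \<Longrightarrow> g k = g' k) \<Longrightarrow> \<phi> g = \<phi> g'" "{i, i + 1} \<subseteq> S" "\<And>k. k \<in> S \<Longrightarrow> g k = g' k"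
  shows "hop i x \<phi> g = hop i x \<phi> g'"
proof -
  have "\<phi> g = \<phi> g'" by (rule assms(1)) (rule assms(3))
  moreover have "\<phi> (g \<circ> swp {i}) = \<phi> (g' \<circ> swp {i})"
    by (rule assms(1)) (use assms(2,3) in \<open>auto simp: swp_def\<close>)
  ultimately show ?thesis using assms(2,3) by (simp add: hop_def)
qed

lemma row_cong:
  assumes "\<And>g g'. (\<And>k. k \<in> S \<Longrightarrow> g k = g' k) \<Longrightarrow> \<phi> g = \<phi> g'" "{i..i + int m} \<subseteq> S" "\<And>k. k \<in> S \<Longrightarrow> g k = g' k"
  shows "row i m x \<phi> g = row i m x \<phi> g'"
  using assms(2,3)
proof (induction m arbitrary: g g')
  case 0
  show ?case unfolding row.simps by (rule assms(1)) (rule 0(2))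
next
  case (Suc m)
  have "{i..i + int m} \<subseteq> S" using Suc.prems(1) by auto
  note IH = Suc.IH [OF this]
  show ?case unfolding row.simps
    by (rule hop_cong [of S, OF IH]) (use Suc.prems in auto)
qed

text \<open>Sites from \<open>i\<close> on never move the entry at \<open>j < i\<close>, so a test
  on it passes through the row. Such tests later pin the outgoing value of a carrier.\<close>

lemma row_guard:
  assumes "j < i"
  shows "row i m x (\<lambda>g. if g j = p then \<phi> g else 0) = (\<lambda>g. if g j = p then row i m x \<phi> g else 0)"
proof (induction m)
  case (Suc m)
  have "swp {i + int m} j = j" using assms by (simp add: swp_def)
  then show ?case by (auto simp: Suc fun_eq_iff hop_def)
qed (simp add: fun_eq_iff)

section \<open>Schubert polynomials\<close>

text \<open>With \<open>m = n - 1\<close> this is the Fomin-Stanley product, in which the row of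
  \<open>\<xi> j\<close> runs over the sites from \<open>n - 1\<close> down to \<open>j\<close>. A
  smaller \<open>m\<close> keeps the innermost \<open>m\<close> rows.\<close>

fun stairs :: "nat \<Rightarrow> (nat \<Rightarrow> 'a::comm_ring_1) \<Rightarrow> nat \<Rightarrow> ((int \<Rightarrow> int) \<Rightarrow> 'a) \<Rightarrow> (int \<Rightarrow> int) \<Rightarrow> 'a" where
  "stairs n \<xi> 0 \<phi> = \<phi>"
| "stairs n \<xi> (Suc m) \<phi> = row (int n - int (Suc m)) (Suc m) (\<xi> (n - Suc m)) (stairs n \<xi> m \<phi>)"

lemma hop_lincomb: "hop i x (\<lambda>g. \<phi> g + d * \<psi> g) = (\<lambda>g. hop i x \<phi> g + d * hop i x \<psi> g)"
  by (auto simp: hop_def fun_eq_iff algebra_simps)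

lemma row_lincomb: "row i m x (\<lambda>g. \<phi> g + d * \<psi> g) = (\<lambda>g. row i m x \<phi> g + d * row i m x \<psi> g)"
  by (induction m) (simp_all add: hop_lincomb)

lemma stairs_lincomb:
  "stairs n \<xi> m (\<lambda>g. \<phi> g + d * \<psi> g) = (\<lambda>g. stairs n \<xi> m \<phi> g + d * stairs n \<xi> m \<psi> g)"
  by (induction m) (simp_all add: row_lincomb hop_lincomb del: row.simps)

lemma stairs_cong:
  assumes "\<And>j. n - m \<le> j \<Longrightarrow> j < n \<Longrightarrow> \<xi> j = \<xi>' j" "m \<le> n"
  shows "stairs n \<xi> m \<phi> = stairs n \<xi>' m \<phi>"
  using assms by (induction m) (simp_all del: row.simps)

lemma stairs_hop_commute:
  assumes "j + 2 + int m \<le> int n"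
  shows "stairs n \<xi> m (hop j y \<phi>) = hop j y (stairs n \<xi> m \<phi>)"
  using assms by (induction m) (simp_all add: row_hop_commute del: row.simps)

text \<open>The top site of the outer row is split as \<open>y + (x - y)\<close>.
  \<open>row_exchange\<close> moves the surplus factor to site \<open>i\<close> inside the two outer
  rows, and it commutes with the remaining rows, whose sites are at least
  \<open>i + 2\<close>.\<close>

lemma stairs_exchange_bottom:
  fixes \<xi> :: "nat \<Rightarrow> 'a::comm_ring_1"
  assumes m: "m < n" and i: "i = n - Suc m"
  shows "stairs n \<xi> (Suc m) \<phi> = stairs n (\<xi> \<circ> swapnat i) (Suc m) (hop (int i) (\<xi> i - \<xi> (i + 1)) \<phi>)"
proof -
  have ii: "int n - int (Suc m) = int i" using m i by simp
  \<comment> \<open>For \<open>m = 0\<close> truncated subtraction gives \<open>m - 1 = 0\<close>,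
    and both sides are \<open>\<psi>\<close>.\<close>
  have top: "stairs n \<zeta> m \<psi> = row (int i + 1) m (\<zeta> (i + 1)) (stairs n \<zeta> (m - 1) \<psi>)"
    for \<zeta> :: "nat \<Rightarrow> 'a" and \<psi>
  proof (cases m)
    case (Suc k)
    then have "int n - int (Suc k) = int i + 1" "n - Suc k = i + 1" using i m by auto
    then show ?thesis unfolding Suc by (simp only: stairs.simps diff_Suc_1)
  qed simp
  let ?x = "\<xi> i" and ?y = "\<xi> (i + 1)"
  let ?Q = "stairs n \<xi> (m - 1) \<phi>"
  have Q: "stairs n (\<xi> \<circ> swapnat i) (m - 1) (hop (int i) (?x - ?y) \<phi>) = hop (int i) (?x - ?y) ?Q"
  proof (cases m)
    case 0
    then show ?thesis by simp
  next
    case (Suc k)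
    have "stairs n (\<xi> \<circ> swapnat i) (m - 1) \<psi> = stairs n \<xi> (m - 1) \<psi>" for \<psi>
      by (rule stairs_cong) (use Suc m i in \<open>auto simp: swapnat_def\<close>)
    then show ?thesis using Suc i m by (simp add: stairs_hop_commute)
  qed
  have "stairs n \<xi> (Suc m) \<phi> = hop (int i + int m) (?y + (?x - ?y)) (row (int i) m ?x (row (int i + 1) m ?y ?Q))"
    by (simp only: stairs.simps ii i [symmetric] top row.simps) simp
  also have "\<dots> = hop (int i + int m) ?y (row (int i) m ?y (row (int i + 1) m ?x (hop (int i) (?x - ?y) ?Q)))"
    unfolding hop_add [symmetric] row_exchange ..
  also have "\<dots> = stairs n (\<xi> \<circ> swapnat i) (Suc m) (hop (int i) (?x - ?y) \<phi>)"
    unfolding stairs.simps ii i [symmetric] top Q by (simp add: swapnat_def)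
  finally show ?thesis .
qed

text \<open>The rows outside row \<open>i\<close> use variables of smaller index, which the swap
  leaves alone, so the case where row \<open>i\<close> is outermost propagates outwards.\<close>

lemma stairs_exchange:
  fixes \<xi> :: "nat \<Rightarrow> 'a::comm_ring_1"
  assumes "i < n" "n \<le> i + m" "m \<le> n"
  shows "stairs n \<xi> m \<phi> = stairs n (\<xi> \<circ> swapnat i) m (hop (int i) (\<xi> i - \<xi> (i + 1)) \<phi>)"
  using assms(2,3)
proof (induction m)
  case (Suc m)
  show ?case
  proof (cases "n \<le> i + m")
    case True
    then have "n - Suc m < i" using Suc.prems assms(1) by linarith
    then have "swapnat i (n - Suc m) = n - Suc m" by (simp add: swapnat_def)
    then show ?thesis using True Suc by (simp del: row.simps)
  next
    case False
    then have "i = n - Suc m" "m < n" using Suc.prems by auto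
    then show ?thesis by (intro stairs_exchange_bottom)
  qed
qed (use assms(1) in simp)

definition nilc :: "int \<Rightarrow> ((int \<Rightarrow> int) \<Rightarrow> 'a::comm_ring_1) \<Rightarrow> (int \<Rightarrow> int) \<Rightarrow> 'a" where
  "nilc i \<phi> w = (if w i < w (i + 1) then \<phi> (w \<circ> swp {i}) else 0)"

lemma hop_eq_nilc: "hop i x \<phi> = (\<lambda>g. \<phi> g + x * nilc i \<phi> g)"
  by (auto simp: hop_def nilc_def)

lemma nilc_nilc: "nilc i (nilc i \<phi>) = (\<lambda>g. 0)"
  by (rule ext, unfold nilc_def comp_swp_apply) simp

text \<open>Applied to \<open>nilc (int i) \<phi>\<close>, the exchange identity loses its
  correction term because \<open>nilc\<close> squares to zero, so that value is symmetric in the two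
  variables. Applied to \<open>\<phi>\<close> it then yields the divided difference.\<close>

lemma stairs_divided_difference:
  fixes \<xi> :: "nat \<Rightarrow> 'a::comm_ring_1"
  assumes "i < n" "n \<le> i + m" "m \<le> n"
  shows "stairs n \<xi> m \<phi> g - stairs n (\<xi> \<circ> swapnat i) m \<phi> g =
    (\<xi> i - \<xi> (i + 1)) * stairs n \<xi> m (nilc (int i) \<phi>) g"
proof -
  have "stairs n \<xi> m (nilc (int i) \<phi>) = stairs n (\<xi> \<circ> swapnat i) m (nilc (int i) \<phi>)"
    using stairs_exchange [OF assms, of \<xi> "nilc (int i) \<phi>"] by (simp add: hop_eq_nilc nilc_nilc)
  moreover have "stairs n \<xi> m \<phi> g = stairs n (\<xi> \<circ> swapnat i) m \<phi> g +
      (\<xi> i - \<xi> (i + 1)) * stairs n (\<xi> \<circ> swapnat i) m (nilc (int i) \<phi>) g"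
    using stairs_exchange [OF assms, of \<xi> \<phi>] by (simp add: hop_eq_nilc stairs_lincomb)
  ultimately show ?thesis by simp
qed

lemma stairs_hom:
  fixes \<sigma> :: "'a::comm_ring_1 \<Rightarrow> 'b::comm_ring_1"
  assumes add: "\<And>a b. \<sigma> (a + b) = \<sigma> a + \<sigma> b" and mult: "\<And>a b. \<sigma> (a * b) = \<sigma> a * \<sigma> b"
    and zero: "\<sigma> 0 = 0"
  shows "\<sigma> (stairs n \<xi> m \<phi> g) = stairs n (\<sigma> \<circ> \<xi>) m (\<sigma> \<circ> \<phi>) g"
proof -
  have hop: "\<sigma> \<circ> hop i x \<psi> = hop i (\<sigma> x) (\<sigma> \<circ> \<psi>)" for i x \<psi>
    by (auto simp: hop_def fun_eq_iff add mult zero)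
  have row: "\<sigma> \<circ> row i k x \<psi> = row i k (\<sigma> x) (\<sigma> \<circ> \<psi>)" for i k x \<psi>
    by (induct k) (simp_all only: row.simps hop)
  have "\<sigma> \<circ> stairs n \<xi> m \<phi> = stairs n (\<sigma> \<circ> \<xi>) m (\<sigma> \<circ> \<phi>)"
  proof (induct m)
    case (Suc m)
    have "(\<sigma> \<circ> \<xi>) (n - Suc m) = \<sigma> (\<xi> (n - Suc m))" by simp
    then show ?case by (simp only: stairs.simps row Suc)
  qed simp
  then show ?thesis by (metis comp_apply)
qed

lemma stairs_closed:
  assumes "\<And>a b. P a \<Longrightarrow> P b \<Longrightarrow> P (a + b)" "\<And>a b. P a \<Longrightarrow> P b \<Longrightarrow> P (a * b)" "P 0"
    "\<And>i. P (\<xi> i)" "\<And>g. P (\<phi> g)"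
  shows "P (stairs n \<xi> m \<phi> g)"
proof -
  have hop: "P (hop i x \<psi> g)" if "P x" "\<And>g. P (\<psi> g)" for i x \<psi> g
    using that assms(1,2,3) by (simp add: hop_def)
  have row: "P (row i k x \<psi> g)" if "P x" "\<And>g. P (\<psi> g)" for i k x \<psi> g
    using that by (induction k arbitrary: g) (simp_all add: hop)
  show ?thesis
    by (induction m arbitrary: g) (simp_all add: row assms(4,5) del: row.simps)
qed

lemma stairs_zero: "stairs n \<xi> m (\<lambda>g. 0) = (\<lambda>g. 0)"
  using stairs_lincomb [of n \<xi> m "\<lambda>g. 0" 1 "\<lambda>g. 0"] by (simp add: fun_eq_iff)

lemma stairs_guard:
  assumes "j + int m < int n"
  shows "stairs n \<xi> m (\<lambda>g. if g j = p then \<phi> g else 0) = (\<lambda>g. if g j = p then stairs n \<xi> m \<phi> g else 0)"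
  using assms
proof (induction m)
  case (Suc m)
  then have "stairs n \<xi> m (\<lambda>g. if g j = p then \<phi> g else 0) = (\<lambda>g. if g j = p then stairs n \<xi> m \<phi> g else 0)"
    by simp
  then show ?case unfolding stairs.simps using Suc.prems by (simp only: row_guard)
qed (simp add: fun_eq_iff)

lemma row_unreachable:
  assumes \<phi>: "\<And>g. g i \<noteq> M \<Longrightarrow> \<phi> g = 0" and "\<And>k. i \<le> k \<Longrightarrow> k \<le> i + int m \<Longrightarrow> w k \<noteq> M"
  shows "row i m x \<phi> w = 0"
  using assms(2)
proof (induction m arbitrary: w)
  case (Suc m)
  have "row i m x \<phi> w = 0" "row i m x \<phi> (w \<circ> swp {i + int m}) = 0"
    by (rule Suc.IH, use Suc.prems in \<open>simp add: swp_def\<close>)+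
  then show ?case by (simp add: hop_def)
qed (simp add: \<phi>)

text \<open>\<open>M\<close> reaches site \<open>i\<close> only if all \<open>m\<close> swaps are
  made: once one is skipped, \<open>M\<close> lies beyond the reach of the remaining sites. All
  \<open>m\<close> swaps are ascents because \<open>M\<close> exceeds every entry it passes, so a
  single term survives.\<close>

lemma row_carry:
  assumes \<phi>: "\<And>g. g i \<noteq> M \<Longrightarrow> \<phi> g = 0" and "w (i + int m) = M" "\<And>k. i \<le> k \<Longrightarrow> k < i + int m \<Longrightarrow> w k < M"
  shows "row i m x \<phi> w = x ^ m * \<phi> (\<lambda>k. if k = i then M else if i < k \<and> k \<le> i + int m then w (k - 1) else w k)"
  using assms(2,3)
proof (induction m arbitrary: w)
  case 0
  then have "(\<lambda>k. if k = i then M else if i < k \<and> k \<le> i + int 0 then w (k - 1) else w k) = w"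
    by auto
  then show ?case by simp
next
  case (Suc m)
  let ?v = "w \<circ> swp {i + int m}"
  have "row i m x \<phi> w = 0"
    by (rule row_unreachable [of i M, OF \<phi>]) (use Suc.prems(2) in force)+
  moreover have "row i m x \<phi> ?v =
      x ^ m * \<phi> (\<lambda>k. if k = i then M else if i < k \<and> k \<le> i + int m then ?v (k - 1) else ?v k)"
    by (rule Suc.IH) (use Suc.prems in \<open>auto simp: swp_def ac_simps\<close>)
  moreover have "(\<lambda>k. if k = i then M else if i < k \<and> k \<le> i + int m then ?v (k - 1) else ?v k) =
      (\<lambda>k. if k = i then M else if i < k \<and> k \<le> i + int (Suc m) then w (k - 1) else w k)"
    by (auto simp: fun_eq_iff swp_def)
  moreover have "w (i + int m) < w (i + int m + 1)" using Suc.prems by (simp add: ac_simps)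
  ultimately show ?case by (simp add: hop_def)
qed

text \<open>Agreement is asked on one window only, because \<open>swp {i}\<close> moves two entries
  while \<open>sref\<close> acts on all periods at once; on the window they coincide for
  \<open>1 \<le> i < n\<close>.\<close>

definition wdelta :: "nat \<Rightarrow> (int \<Rightarrow> int) \<Rightarrow> (int \<Rightarrow> int) \<Rightarrow> 'a::comm_ring_1" where
  "wdelta n v g = (if \<forall>k\<in>{1..int n}. g k = v k then 1 else 0)"

text \<open>Before position \<open>n - m\<close> the argument already agrees with \<open>w0\<close>;
  the last \<open>m + 1\<close> entries still increase. The outermost row must carry the largest of
  these to their front, using every site, and what remains is the same problem for a smaller
  \<open>m\<close>.\<close>

lemma stairs_top:
  assumes "m < n" "\<And>k. 1 \<le> k \<Longrightarrow> k < int n - int m \<Longrightarrow> g k = int n + 1 - k"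
    "\<And>k. int n - int m \<le> k \<Longrightarrow> k \<le> int n \<Longrightarrow> g k = k - (int n - int m) + 1"
  shows "stairs n \<xi> m (wdelta n (w0 n)) g = (\<Prod>j\<in>{n - m..<n}. \<xi> j ^ (n - j))"
  using assms
proof (induction m arbitrary: g)
  case 0
  have "g k = w0 n k" if "k \<in> {1..int n}" for k
  proof -
    have "w0 n k = int n + 1 - k" using that by (simp add: w0_def div_pos_pos_trivial)
    then show ?thesis using 0(2,3) [of k] that by (cases "k = int n") auto
  qed
  then show ?case by (simp add: wdelta_def)
next
  case (Suc m)
  define i where "i = n - Suc m"
  have i: "int n - int (Suc m) = int i" "int i + int (Suc m) = int n" "1 \<le> i" "i < n" "n - i = Suc m"
    using Suc.prems(1) by (auto simp: i_def)
  let ?M = "int n + 1 - int i" and ?\<phi> = "stairs n \<xi> m (wdelta n (w0 n))"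
  have w0i: "w0 n (int i) = ?M" using i by (simp add: w0_def div_pos_pos_trivial)
  \<comment> \<open>The inner rows never touch site \<open>i\<close>, so an argument that lacks the
    value of \<open>w0\<close> there contributes nothing.\<close>
  have zero: "?\<phi> h = 0" if "h (int i) \<noteq> ?M" for h
  proof -
    let ?\<delta> = "\<lambda>g. if g (int i) = ?M then wdelta n (w0 n) g else 0"
    have "wdelta n (w0 n) = ?\<delta>"
      using i w0i by (auto simp: wdelta_def fun_eq_iff)
    then have "?\<phi> h = stairs n \<xi> m ?\<delta> h" by (rule arg_cong)
    also have "\<dots> = (if h (int i) = ?M then ?\<phi> h else 0)"
      using i by (subst stairs_guard) simp_all
    finally show ?thesis using that by simp
  qed
  let ?g = "\<lambda>k. if k = int i then ?M else if int i < k \<and> k \<le> int i + int (Suc m) then g (k - 1) else g k"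
  have "stairs n \<xi> (Suc m) (wdelta n (w0 n)) g = row (int i) (Suc m) (\<xi> i) ?\<phi> g"
    by (simp only: stairs.simps i i_def [symmetric])
  also have "\<dots> = \<xi> i ^ Suc m * ?\<phi> ?g"
    by (rule row_carry [OF zero]) (use Suc.prems i in auto)
  also have "?\<phi> ?g = (\<Prod>j\<in>{n - m..<n}. \<xi> j ^ (n - j))"
    by (rule Suc.IH) (use Suc.prems i in auto)
  also have "{n - Suc m..<n} = insert i {n - m..<n}" using i by auto
  then have "\<xi> i ^ Suc m * (\<Prod>j\<in>{n - m..<n}. \<xi> j ^ (n - j)) = (\<Prod>j\<in>{n - Suc m..<n}. \<xi> j ^ (n - j))"
    using i by simp
  finally show ?case .
qed

section \<open>Swapping variables and divided differences of polynomials\<close>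

lemma swapnat_invol: "swapnat i (swapnat i k) = k"
  by (simp add: swapnat_def)

lemma inj_swapnat: "inj (swapnat i)"
  by (metis injI swapnat_invol)

lemma poly_mapping_add_induct [case_names zero single add]:
  fixes p :: "'a \<Rightarrow>\<^sub>0 'b::monoid_add"
  assumes "P 0" "\<And>a c. P (Poly_Mapping.single a c)" "\<And>p q. P p \<Longrightarrow> P q \<Longrightarrow> P (p + q)"
  shows "P p"
proof (induction p rule: update_induct)
  case (update f a b)
  have "Poly_Mapping.update a b f = f + Poly_Mapping.single a b"
    using update(1) by (intro poly_mapping_eqI) (auto simp: lookup_update lookup_add lookup_single in_keys_iff when_def)
  then show ?case using assms update by simp
qed (rule assms)

abbreviation swapexp :: "nat \<Rightarrow> (nat \<Rightarrow>\<^sub>0 nat) \<Rightarrow> (nat \<Rightarrow>\<^sub>0 nat)" where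
  "swapexp i \<equiv> Poly_Mapping.map_key (swapnat i)"

lemma swapexp_invol: "swapexp i (swapexp i a) = a"
proof -
  have "swapnat i \<circ> swapnat i = (\<lambda>x. x)" by (auto simp: swapnat_invol)
  then show ?thesis using map_key_compose [OF inj_swapnat inj_swapnat] by (metis map_key_id)
qed

lemma inj_swapexp: "inj (swapexp i)"
  by (metis injI swapexp_invol)

lemma swapv_zero: "swapv i 0 = 0"
  by (simp add: swapv_def inj_swapexp)

lemma swapv_add: "swapv i (p + q) = swapv i p + swapv i q"
  by (simp add: swapv_def map_key_plus [OF inj_swapexp])

lemma swapv_single: "swapv i (Poly_Mapping.single a c) = Poly_Mapping.single (swapexp i a) c"
  using map_key_single [OF inj_swapexp, of i "swapexp i a" c] by (simp add: swapv_def swapexp_invol)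

lemma swapv_mult: "swapv i (p * q) = swapv i p * swapv i q"
proof (induction p rule: poly_mapping_add_induct)
  case (single a c)
  show ?case
    by (induction q rule: poly_mapping_add_induct)
      (simp_all add: swapv_zero swapv_add swapv_single mult_single map_key_plus [OF inj_swapnat] ring_distribs)
qed (simp_all add: swapv_zero swapv_add ring_distribs)

lemma swapv_one: "swapv i 1 = 1"
  by (simp add: single_one [symmetric] swapv_single inj_swapnat del: single_one)

lemma swapv_Xvar: "swapv i (Xvar k) = Xvar (swapnat i k)"
  using map_key_single [OF inj_swapnat, of i "swapnat i k" "1::nat"]
  by (simp add: Xvar_def swapv_single swapnat_invol)

lemma Xvar_inj: "Xvar i = Xvar j \<Longrightarrow> i = j"
proof -
  assume "Xvar i = Xvar j"
  then have "Poly_Mapping.keys (Xvar i) = Poly_Mapping.keys (Xvar j)" by simp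
  then have "Poly_Mapping.single i (1::nat) = Poly_Mapping.single j 1" by (simp add: Xvar_def)
  then have "Poly_Mapping.keys (Poly_Mapping.single i (1::nat)) = Poly_Mapping.keys (Poly_Mapping.single j (1::nat))" by simp
  then show "i = j" by simp
qed

text \<open>Cancellation in the integral domain of polynomials makes the quotient unique, so
  exhibiting one determines the \<open>THE\<close>.\<close>

lemma ddiff_eqI:
  assumes "(Xvar i - Xvar (i + 1)) * g = f - swapv i f"
  shows "ddiff i f = g"
  unfolding ddiff_def
proof (rule the_equality)
  fix h assume "(Xvar i - Xvar (i + 1)) * h = f - swapv i f"
  then have "(Xvar i - Xvar (i + 1)) * h = (Xvar i - Xvar (i + 1)) * g" using assms by simp
  moreover have "Xvar i - Xvar (i + 1) \<noteq> 0" using Xvar_inj [of i "i + 1"] by auto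
  ultimately show "h = g" by simp
qed (rule assms)

text \<open>Evaluation at \<open>id\<close> with a delta function at \<open>v\<close> extracts the
  coefficient of \<open>v\<close> in the Fomin-Stanley product, classically the Schubert polynomial
  of \<open>v\<close>.\<close>

definition schub_stairs :: "nat \<Rightarrow> (int \<Rightarrow> int) \<Rightarrow> mpoly" where
  "schub_stairs n v = stairs n Xvar (n - 1) (wdelta n v) id"

lemma nilc_wdelta:
  assumes "i \<in> {1..<n}"
  shows "nilc (int i) (wdelta n v) =
    (\<lambda>g. if v (int i + 1) < v (int i) then wdelta n (v \<circ> sref n i) g else 0)"
proof
  fix g :: "int \<Rightarrow> int"
  have n2: "n \<ge> 2" using assms by simp
  have s: "sref n i k = swp {int i} k" if "k \<in> {1..int n}" for k
  proof -
    have "k mod int n = int i \<longleftrightarrow> k = int i" using that assms by (cases "k = int n") auto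
    moreover have "(k - 1) mod int n = int i \<longleftrightarrow> k - 1 = int i" using that assms by auto
    ultimately show ?thesis using assms by (subst sref_eq [OF n2]) (auto simp: swp_def)
  qed
  have sin: "swp {int i} k \<in> {1..int n}" if "k \<in> {1..int n}" for k
    using that assms by (auto simp: swp_def)
  have inv: "swp {int i} (swp {int i} k) = k" for k by (auto simp: swp_def)
  have iff: "(\<forall>k\<in>{1..int n}. (g \<circ> swp {int i}) k = v k) \<longleftrightarrow> (\<forall>k\<in>{1..int n}. g k = (v \<circ> sref n i) k)"
    by (metis comp_apply inv s sin)
  have "g (int i) = v (int i + 1)" "g (int i + 1) = v (int i)" if "\<forall>k\<in>{1..int n}. g k = (v \<circ> sref n i) k"
    using that assms by (auto simp: s swp_def)
  then show "nilc (int i) (wdelta n v) g = (if v (int i + 1) < v (int i) then wdelta n (v \<circ> sref n i) g else 0)"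
    unfolding nilc_def wdelta_def iff by auto
qed

text \<open>The delta function takes only the constants 0 and 1, so \<open>swapv\<close> merely
  permutes the variables of the staircase, and \<open>stairs_divided_difference\<close> moves the
  effect onto the target \<open>v\<close>.\<close>

lemma ddiff_schub_stairs:
  assumes "i \<in> {1..<n}"
  shows "ddiff i (schub_stairs n v) =
    (if v (int i + 1) < v (int i) then schub_stairs n (v \<circ> sref n i) else 0)"
proof (rule ddiff_eqI)
  have "swapv i (schub_stairs n v) = stairs n (swapv i \<circ> Xvar) (n - 1) (swapv i \<circ> wdelta n v) id"
    unfolding schub_stairs_def by (rule stairs_hom) (simp_all add: swapv_add swapv_mult swapv_zero)
  moreover have "swapv i \<circ> Xvar = Xvar \<circ> swapnat i" by (auto simp: swapv_Xvar)
  moreover have "swapv i \<circ> wdelta n v = wdelta n v" by (auto simp: wdelta_def swapv_one swapv_zero)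
  ultimately have "schub_stairs n v - swapv i (schub_stairs n v) =
      (Xvar i - Xvar (i + 1)) * stairs n Xvar (n - 1) (nilc (int i) (wdelta n v)) id"
    unfolding schub_stairs_def using assms stairs_divided_difference [of i n "n - 1" Xvar "wdelta n v" id]
    by auto
  also have "stairs n Xvar (n - 1) (nilc (int i) (wdelta n v)) id =
      (if v (int i + 1) < v (int i) then schub_stairs n (v \<circ> sref n i) else 0)"
    by (simp add: nilc_wdelta [OF assms] schub_stairs_def stairs_zero)
  finally show "(Xvar i - Xvar (i + 1)) * (if v (int i + 1) < v (int i) then schub_stairs n (v \<circ> sref n i) else 0) =
      schub_stairs n v - swapv i (schub_stairs n v)" by simp
qed

lemma schub_stairs_top:
  assumes "n > 0"
  shows "schub_stairs n (w0 n) = schub_top n"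
  using stairs_top [of "n - 1" n id Xvar] assms by (simp add: schub_stairs_def schub_top_def)

lemma lookup_mult_nonneg:
  fixes p q :: mpoly
  assumes "\<And>a. Poly_Mapping.lookup p a \<ge> 0" "\<And>a. Poly_Mapping.lookup q a \<ge> 0"
  shows "Poly_Mapping.lookup (p * q) a \<ge> 0"
  unfolding lookup_mult Sum_any.expand_set
  by (intro sum_nonneg mult_nonneg_nonneg assms) (simp add: when_def assms)

lemma schub_stairs_nonneg: "Poly_Mapping.lookup (schub_stairs n v) a \<ge> 0"
proof -
  have "\<forall>a. Poly_Mapping.lookup (schub_stairs n v) a \<ge> 0"
    unfolding schub_stairs_def
    by (rule stairs_closed [where P = "\<lambda>p. \<forall>a. Poly_Mapping.lookup p a \<ge> 0"])
      (auto simp: lookup_add lookup_mult_nonneg Xvar_def lookup_single wdelta_def lookup_one when_def)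
  then show ?thesis ..
qed

text \<open>Being 0 or some \<open>schub_stairs n v\<close> survives each divided difference, along
  any word. Hence whichever word \<open>schub\<close> selects, its result is covered.\<close>

lemma fold_ddiff_nonneg:
  assumes "set ws \<subseteq> {1..<n}" "p = 0 \<or> (\<exists>v. p = schub_stairs n v)"
  shows "Poly_Mapping.lookup (fold ddiff ws p) a \<ge> 0"
  using assms
proof (induction ws arbitrary: p)
  case Nil
  then show ?case using schub_stairs_nonneg by auto
next
  case (Cons i ws)
  have "ddiff i 0 = 0" by (rule ddiff_eqI) (simp add: swapv_zero)
  moreover have "ddiff i (schub_stairs n v) = 0 \<or> (\<exists>v'. ddiff i (schub_stairs n v) = schub_stairs n v')" for v
    using Cons.prems(1) by (subst (1 2) ddiff_schub_stairs) auto
  ultimately have "ddiff i p = 0 \<or> (\<exists>v. ddiff i p = schub_stairs n v)"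
    using Cons.prems(2) by metis
  then show ?case using Cons by simp
qed

context
  fixes n :: nat
  assumes n2: "n \<ge> 2"
begin

lemma w0_invol: "w0 n (w0 n i) = i"
proof -
  have "w0 n i - 1 = (int n - 1 - (i - 1) mod int n) + (i - 1) div int n * int n"
    by (simp add: w0_def)
  moreover have "0 \<le> int n - 1 - (i - 1) mod int n" "int n - 1 - (i - 1) mod int n < int n"
    using n2 pos_mod_bound [of "int n" "i - 1"] pos_mod_sign [of "int n" "i - 1"] by linarith+
  ultimately have "(w0 n i - 1) div int n = (i - 1) div int n"
    "(w0 n i - 1) mod int n = int n - 1 - (i - 1) mod int n"
    using n2 by (simp_all only: div_mult_self1 mod_mult_self1 div_pos_pos_trivial mod_pos_pos_trivial)
  then have "w0 n (w0 n i) = (i - 1) div int n * int n + (i - 1) mod int n + 1"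
    by (simp add: w0_def)
  then show ?thesis by simp
qed

lemma w0_window: "k \<in> {1..int n} \<Longrightarrow> w0 n k = int n + 1 - k"
  by (simp add: w0_def div_pos_pos_trivial)

lemma fin_perm_w0: "fin_perm n (w0 n)"
proof -
  have "w0 n \<circ> w0 n = id" by (auto simp: w0_invol)
  then have bij: "bij (w0 n)" by (rule o_bij) fact
  have "w0 n (i + int n) = w0 n i + int n" for i
  proof -
    have "(i + int n - 1) div int n = (i - 1) div int n + 1" "(i + int n - 1) mod int n = (i - 1) mod int n"
      using n2 div_add_self2 [of "int n" "i - 1"] mod_add_self2 [of "i - 1" "int n"]
      by (simp_all add: algebra_simps)
    then show ?thesis by (simp add: w0_def algebra_simps)
  qed
  moreover have "(\<Sum>i\<in>{1..int n}. w0 n i) = (\<Sum>i\<in>{1..int n}. i)"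
    by (rule sum.reindex_bij_witness [where i = "w0 n" and j = "w0 n"]) (auto simp: w0_window)
  ultimately have "affine_perm n (w0 n)" using bij gauss_int [OF n2] by (simp add: affine_perm_def)
  moreover have "w0 n ` {1..int n} = {1..int n}"
    using bij by (intro card_subset_eq) (auto simp: w0_window card_image bij_def inj_on_subset)
  ultimately show ?thesis by (simp add: fin_perm_def)
qed

lemma schub_nonneg:
  assumes "fin_perm n v"
  shows "Poly_Mapping.lookup (schub n v) a \<ge> 0"
proof -
  let ?u = "w0 n \<circ> v"
  have aff: "affine_perm n ?u"
    using assms fin_perm_w0 affine_perm_comp [OF n2] by (auto simp: fin_perm_def)
  moreover have "?u ` {1..int n} = {1..int n}"
    using assms fin_perm_w0 by (metis fin_perm_def image_comp)
  ultimately have "fin_perm n ?u" by (simp add: fin_perm_def)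
  then obtain ws where ws: "set ws \<subseteq> {1..<n}" "word_prod n ws = ?u" "length ws = alen n ?u"
    using ex_reduced_word [OF n2 aff] alen_eq_ainv [OF n2 aff] by auto
  then have "\<exists>p. \<exists>ws. set ws \<subseteq> {1..<n} \<and> word_prod n ws = ?u \<and> length ws = alen n ?u \<and>
      p = fold ddiff ws (schub_top n)" by blast
  from someI_ex [OF this] obtain ws where "set ws \<subseteq> {1..<n}" "schub n v = fold ddiff ws (schub_top n)"
    unfolding schub_def by blast
  then show ?thesis using fold_ddiff_nonneg schub_stairs_top n2
    by (metis less_le_trans zero_less_numeral)
qed

end

section \<open>Cyclically decreasing elements\<close>

text \<open>The first integer from k on outside A, where the block through k ends; meaningless if there is none.\<close>

definition bend :: "int set \<Rightarrow> int \<Rightarrow> int" where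
  "bend A k = k + int (LEAST d. k + int d \<notin> A)"

text \<open>In \<open>w \<circ> cshift A\<close>, with blocks ending at the positions outside
  \<open>A\<close>, the last entry of each block has moved to its front.\<close>

definition cshift :: "int set \<Rightarrow> int \<Rightarrow> int" where
  "cshift A k = (if k - 1 \<in> A then k - 1 else bend A k)"

definition gappy :: "int set \<Rightarrow> bool" where
  "gappy A \<longleftrightarrow> (\<forall>k. \<exists>j\<ge>k. j \<notin> A)"

text \<open>Each block ends in its strict maximum; for periodic sets this becomes the criterion for
  length-additivity in \<open>alen_comp_cshift\<close>.\<close>

definition ascending :: "(int \<Rightarrow> int) \<Rightarrow> int set \<Rightarrow> bool" where
  "ascending w A \<longleftrightarrow> (\<forall>k\<in>A. w k < w (bend A k))"

lemma bend_ge: "k \<le> bend A k"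
  by (simp add: bend_def)

lemma bend_eqI:
  assumes "k \<le> j" "j \<notin> A" "\<And>i. k \<le> i \<Longrightarrow> i < j \<Longrightarrow> i \<in> A"
  shows "bend A k = j"
proof -
  have "(LEAST d. k + int d \<notin> A) = nat (j - k)"
  proof (rule Least_equality)
    show "k + int (nat (j - k)) \<notin> A" using assms by simp
    fix d assume d: "k + int d \<notin> A"
    show "nat (j - k) \<le> d"
    proof (rule ccontr)
      assume "\<not> nat (j - k) \<le> d"
      then have "k + int d < j" by linarith
      then show False using assms(3) [of "k + int d"] d by simp
    qed
  qed
  then show ?thesis using assms(1) by (simp add: bend_def)
qed

lemma bend_notin:
  assumes "gappy A"
  shows "bend A k \<notin> A"
proof -
  obtain j where "j \<ge> k" "j \<notin> A" using assms by (auto simp: gappy_def)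
  then have "k + int (nat (j - k)) \<notin> A" by simp
  then show ?thesis unfolding bend_def by (rule LeastI)
qed

lemma bend_between: "k \<le> i \<Longrightarrow> i < bend A k \<Longrightarrow> i \<in> A"
  using not_less_Least [of "nat (i - k)" "\<lambda>d. k + int d \<notin> A"] by (simp add: bend_def)

lemma bend_outside: "k \<notin> A \<Longrightarrow> bend A k = k"
  by (rule bend_eqI) auto

lemma cshift_empty: "cshift {} = id"
  by (auto simp: cshift_def bend_outside)

text \<open>For \<open>i\<close> in \<open>K\<close>, position \<open>i\<close> ends a block of
  \<open>A\<close> and \<open>i + 1\<close> is a block by itself; adding \<open>K\<close> appends
  the second to the first and moves the end from \<open>i\<close> to \<open>i + 1\<close>. The
  condition on \<open>k\<close> excludes starting at an appended position.\<close>

lemma bend_Un: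
  assumes gap: "gappy A" and disj: "\<And>i. i \<in> K \<Longrightarrow> i \<notin> A \<and> i + 1 \<notin> A \<and> i + 1 \<notin> K"
    and k: "k - 1 \<notin> K"
  shows "bend (A \<union> K) k = swp K (bend A k)"
proof -
  let ?j = "bend A k"
  have j: "k \<le> ?j" "?j \<notin> A" using bend_ge bend_notin [OF gap] by auto
  have prev: "?j - 1 \<notin> K"
  proof (cases "?j = k")
    case False
    then have "?j - 1 \<in> A" using j by (intro bend_between [of k]) auto
    then show ?thesis using disj by auto
  qed (use k in simp)
  show ?thesis
  proof (cases "?j \<in> K")
    case True
    have "bend (A \<union> K) k = ?j + 1"
    proof (rule bend_eqI)
      fix i assume "k \<le> i" "i < ?j + 1"
      then show "i \<in> A \<union> K" using True bend_between [of k i A] by (cases "i = ?j") auto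
    qed (use j disj True in auto)
    then show ?thesis using True by (simp add: swp_def)
  next
    case False
    have "bend (A \<union> K) k = ?j"
      by (rule bend_eqI) (use False j bend_between [of k _ A] in auto)
    then show ?thesis using False prev by (simp add: swp_def)
  qed
qed

lemma cshift_Un:
  assumes gap: "gappy A" and disj: "\<And>i. i \<in> K \<Longrightarrow> i \<notin> A \<and> i + 1 \<notin> A \<and> i + 1 \<notin> K"
  shows "cshift (A \<union> K) = swp K \<circ> cshift A"
proof
  fix k
  consider "k - 1 \<in> A" | "k - 1 \<in> K" | "k - 1 \<notin> A \<union> K" by auto
  then show "cshift (A \<union> K) k = (swp K \<circ> cshift A) k"
  proof cases
    case 1
    then have "k - 1 \<notin> K" "k - 1 - 1 \<notin> K" using disj [of "k - 1"] disj [of "k - 1 - 1"] by auto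
    then show ?thesis using 1 by (simp add: cshift_def swp_def)
  next
    case 2
    then have "k - 1 \<notin> A" "k \<notin> A" "k \<notin> K" using disj [of "k - 1"] by auto
    then show ?thesis using 2 by (simp add: cshift_def swp_def bend_outside)
  next
    case 3
    then show ?thesis using bend_Un [OF assms, of k] by (simp add: cshift_def)
  qed
qed

lemma ascending_Un:
  assumes gap: "gappy A" and disj: "\<And>i. i \<in> K \<Longrightarrow> i \<notin> A \<and> i + 1 \<notin> A \<and> i + 1 \<notin> K"
  shows "ascending w (A \<union> K) \<longleftrightarrow> (\<forall>k\<in>K. w k < w (k + 1)) \<and> ascending (w \<circ> swp K) A"
proof -
  have K: "bend (A \<union> K) k = k + 1" if "k \<in> K" for k
    using that disj by (intro bend_eqI) (auto simp: order_le_less)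
  have A: "bend (A \<union> K) k = swp K (bend A k)" "swp K k = k" if "k \<in> A" for k
  proof -
    have "k - 1 \<notin> K" "k \<notin> K" using that disj [of "k - 1"] disj [of k] by auto
    then show "bend (A \<union> K) k = swp K (bend A k)" "swp K k = k"
      using bend_Un [OF assms, of k] by (simp_all add: swp_def)
  qed
  show ?thesis unfolding ascending_def ball_Un by (auto simp: K A)
qed

text \<open>Swapping at exactly the sites in \<open>A\<close>, from the top down, composes to
  \<open>cshift A\<close>, and every chosen step is an ascent exactly when
  \<open>ascending w A\<close>. The top site lies above all others, which gives the isolation
  required by \<open>cshift_Un\<close> and \<open>ascending_Un\<close>.\<close>

lemma row_expand:
  "row i m x \<Phi> w = (\<Sum>A\<in>Pow {i..<i + int m}. if ascending w A then x ^ card A * \<Phi> (w \<circ> cshift A) else 0)"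
proof (induction m arbitrary: w)
  case 0
  show ?case by (simp add: ascending_def cshift_empty)
next
  case (Suc m)
  let ?a = "i + int m" and ?S = "{i..<i + int m}"
  let ?f = "\<lambda>w A. if ascending w A then x ^ card A * \<Phi> (w \<circ> cshift A) else 0"
  have S: "{i..<i + int (Suc m)} = insert ?a ?S" by auto
  have inj: "inj_on (insert ?a) (Pow ?S)"
  proof (rule inj_onI)
    fix A B assume "A \<in> Pow ?S" "B \<in> Pow ?S" and eq: "insert ?a A = insert ?a B"
    then have "?a \<notin> A" "?a \<notin> B" by auto
    then show "A = B" using eq by (simp add: insert_ident)
  qed
  have ins: "?f w (insert ?a A) = (if w ?a < w (?a + 1) then x * ?f (w \<circ> swp {?a}) A else 0)"
    if A: "A \<in> Pow ?S" for A
  proof -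
    have "gappy A" unfolding gappy_def
    proof
      fix k
      show "\<exists>j\<ge>k. j \<notin> A" using A by (intro exI [of _ "max k ?a"]) auto
    qed
    moreover have disj: "j \<in> {?a} \<Longrightarrow> j \<notin> A \<and> j + 1 \<notin> A \<and> j + 1 \<notin> {?a}" for j using A by auto
    ultimately have "cshift (insert ?a A) = swp {?a} \<circ> cshift A"
      "ascending w (insert ?a A) \<longleftrightarrow> w ?a < w (?a + 1) \<and> ascending (w \<circ> swp {?a}) A"
      using cshift_Un [of A "{?a}"] ascending_Un [of A "{?a}" w] by auto
    moreover have "card (insert ?a A) = Suc (card A)"
      using A disj finite_subset [of A ?S] by auto
    ultimately show ?thesis by (simp add: comp_assoc mult.assoc)
  qed
  have "(\<Sum>A\<in>Pow (insert ?a ?S). ?f w A) = (\<Sum>A\<in>Pow ?S. ?f w A) + (\<Sum>A\<in>insert ?a ` Pow ?S. ?f w A)"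
    unfolding Pow_insert by (rule sum.union_disjoint) auto
  also have "(\<Sum>A\<in>insert ?a ` Pow ?S. ?f w A) =
      (\<Sum>A\<in>Pow ?S. if w ?a < w (?a + 1) then x * ?f (w \<circ> swp {?a}) A else 0)"
    unfolding sum.reindex [OF inj] by (rule sum.cong [OF refl], rule trans [OF comp_apply]) (rule ins)
  also have "\<dots> = (if w ?a < w (?a + 1) then x * (\<Sum>A\<in>Pow ?S. ?f (w \<circ> swp {?a}) A) else 0)"
    by (simp add: sum_distrib_left)
  finally show ?case unfolding S row.simps hop_def Suc.IH [of w] Suc.IH [of "w \<circ> swp {?a}"]
    by simp
qed

section \<open>Periodic position sets and the trace of one carrier pass\<close>

definition per :: "nat \<Rightarrow> nat set \<Rightarrow> int set" where
  "per n A = {k. nat (k mod int n) \<in> A}"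

lemma per_add_period: "k + int n \<in> per n A \<longleftrightarrow> k \<in> per n A"
  by (simp add: per_def)

lemma per_add_mult: "k + int n * q \<in> per n A \<longleftrightarrow> k \<in> per n A"
  by (simp add: per_def)

lemma gappy_per:
  assumes "r < n" "r \<notin> A"
  shows "gappy (per n A)"
  unfolding gappy_def
proof
  fix k
  let ?j = "int r + int n * \<bar>k\<bar>"
  have "\<bar>k\<bar> \<le> int n * \<bar>k\<bar>" using assms(1) by (intro mult_le_cancel_right1 [THEN iffD2]) auto
  then have "?j \<ge> k" by linarith
  moreover have "?j \<notin> per n A" using assms by (simp add: per_def)
  ultimately show "\<exists>j\<ge>k. j \<notin> per n A" by blast
qed

lemma gappy_per_psubset: "A \<subset> {0..<n} \<Longrightarrow> gappy (per n A)"
  using gappy_per [of _ n A] by (metis atLeastLessThan_iff psubset_imp_ex_mem DiffE)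

lemma bend_per_mult:
  assumes "gappy (per n A)"
  shows "bend (per n A) (k + int n * q) = bend (per n A) k + int n * q"
proof (rule bend_eqI)
  fix i assume "k + int n * q \<le> i" "i < bend (per n A) k + int n * q"
  then have "i - int n * q \<in> per n A" by (intro bend_between [of k]) auto
  then show "i \<in> per n A" using per_add_mult [of "i - int n * q" n q A] by simp
qed (use bend_ge bend_notin [OF assms] in \<open>auto simp: per_add_mult\<close>)

lemma ascending_per_window:
  assumes gap: "gappy (per n A)" and n: "n > 0" and w: "shift_equivariant n w"
  shows "ascending w (per n A) \<longleftrightarrow> (\<forall>k\<in>per n A \<inter> {a..<a + int n}. w k < w (bend (per n A) k))"
proof
  assume R: "\<forall>k\<in>per n A \<inter> {a..<a + int n}. w k < w (bend (per n A) k)"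
  show "ascending w (per n A)" unfolding ascending_def
  proof
    fix k assume k: "k \<in> per n A"
    let ?q = "(k - a) div int n" and ?r = "a + (k - a) mod int n"
    have kk: "k = ?r + int n * ?q" by simp
    have "?r \<in> per n A" using k per_add_mult [of ?r n ?q A] kk by metis
    moreover have "?r \<in> {a..<a + int n}" using n by simp
    ultimately have "w ?r < w (bend (per n A) ?r)" using R by blast
    then show "w k < w (bend (per n A) k)"
      by (subst (1 2) kk) (simp only: bend_per_mult [OF gap] periodic_mult [OF w])
  qed
qed (auto simp: ascending_def)

lemma bij_betw_residues: "n > 0 \<Longrightarrow> bij_betw (\<lambda>k. nat (k mod int n)) {a..<a + int n} {0..<n}"
proof (rule bij_betwI [where g = "\<lambda>r. a + (int r - a) mod int n"])
  assume n: "n > 0"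
  show "(\<lambda>k. nat (k mod int n)) \<in> {a..<a + int n} \<rightarrow> {0..<n}" using n by (auto simp: nat_less_iff)
  show "(\<lambda>r. a + (int r - a) mod int n) \<in> {0..<n} \<rightarrow> {a..<a + int n}" using n by auto
  show "a + (int (nat (k mod int n)) - a) mod int n = k" if "k \<in> {a..<a + int n}" for k
  proof -
    have "(int (nat (k mod int n)) - a) mod int n = (k - a) mod int n" using n by (simp add: mod_simps)
    also have "\<dots> = k - a" using that by (intro mod_pos_pos_trivial) auto
    finally show ?thesis by simp
  qed
  show "nat ((a + (int r - a) mod int n) mod int n) = r" if "r \<in> {0..<n}" for r
    using that by (simp add: mod_simps)
qed

text \<open>The position a + n holds the carrier e before the pass, and the guard on position a says that the
  carrier returns shifted by one period. Each proper A admits exactly one such e, and A = {0..<n} admits none.\<close>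

lemma row_trace:
  fixes x :: "'a::comm_ring_1"
  assumes n: "n > 0" and w: "shift_equivariant n w" and F: "finite F" "w ` {a + int n..<a + 2 * int n} \<subseteq> F"
    and g0: "\<And>k. a \<le> k \<Longrightarrow> k < a + int n \<Longrightarrow> g0 k = w k"
    and dep: "\<And>g v. (\<And>k. a < k \<Longrightarrow> k \<le> a + int n \<Longrightarrow> g k = v k) \<Longrightarrow> (\<And>j. j > a + int n \<Longrightarrow> g j = g0 j) \<Longrightarrow> \<Phi> g = \<Psi> v"
  shows "(\<Sum>e\<in>F. row a n x (\<lambda>g. if g a = e - int n then \<Phi> g else 0) (g0(a + int n := e))) =
    (\<Sum>A\<in>{A. A \<subset> {0..<n}}. if ascending w (per n A) then x ^ card A * \<Psi> (w \<circ> cshift (per n A)) else 0)"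
proof -
  let ?W = "{a..<a + int n}"
  let ?\<rho> = "\<lambda>k. nat (k mod int n)"
  let ?R = "\<lambda>A. if ascending w (per n A) then x ^ card A * \<Psi> (w \<circ> cshift (per n A)) else 0"
  let ?G = "\<lambda>e. g0(a + int n := e)"
  let ?L = "\<lambda>e C. if ascending (?G e) C then x ^ card C *
      (if (?G e \<circ> cshift C) a = e - int n then \<Phi> (?G e \<circ> cshift C) else 0) else 0"
  note bij = bij_betw_residues [OF n, of a]
  have key: "(\<Sum>e\<in>F. ?L e C) = (if ?\<rho> ` C \<subset> {0..<n} then ?R (?\<rho> ` C) else 0)" if C: "C \<subseteq> ?W" for C
  proof -
    let ?P = "per n (?\<rho> ` C)"
    have gapC: "gappy C" unfolding gappy_def
    proof
      fix k
      show "\<exists>j\<ge>k. j \<notin> C" using C by (intro exI [of _ "max k (a + int n)"]) auto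
    qed
    have inP: "k \<in> ?P \<longleftrightarrow> k \<in> C" if "k \<in> ?W" for k
      using that C bij unfolding per_def bij_betw_def inj_on_def by blast
    have a1: "a - 1 \<notin> C" using C by auto
    show ?thesis
    proof (cases "C = ?W")
      case True
      \<comment> \<open>When every site swaps, the carrier returns as \<open>e\<close> itself,
        whereas the guard asks for \<open>e - n\<close>.\<close>
      have "bend C a = a + int n" by (rule bend_eqI) (auto simp: True)
      then have "(?G e \<circ> cshift C) a \<noteq> e - int n" for e using a1 n by (simp add: cshift_def)
      then have "(\<Sum>e\<in>F. ?L e C) = 0" by (intro sum.neutral) auto
      moreover have "?\<rho> ` C = {0..<n}" using bij True by (simp add: bij_betw_def)
      ultimately show ?thesis by simp
    next
      case False
      have ps: "?\<rho> ` C \<subset> {0..<n}"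
      proof -
        have "?\<rho> ` C \<noteq> ?\<rho> ` ?W"
          using C False bij by (metis bij_betw_imp_inj_on inj_on_image_eq_iff order_refl)
        then show ?thesis using C bij by (auto simp: bij_betw_def)
      qed
      note gapP = gappy_per_psubset [OF ps]
      \<comment> \<open>The block starting at \<open>a\<close> ends at \<open>p\<close>, so
        \<open>w p\<close> is what the row leaves at \<open>a\<close>; the guard then determines the
        carrier as \<open>w p + n\<close>, the entry at \<open>p + n\<close>.\<close>
      define p where "p = bend C a"
      obtain r where r: "r \<in> ?W" "r \<notin> C" using False C by blast
      have p: "a \<le> p" "p < a + int n" "p \<notin> C"
      proof -
        show "a \<le> p" "p \<notin> C" using bend_ge bend_notin [OF gapC] by (auto simp: p_def)
        have "p \<le> r" using bend_between [of a r C] r unfolding p_def by force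
        then show "p < a + int n" using r by simp
      qed
      have pa: "(?G e \<circ> cshift C) a = w p" for e
        using p g0 [of p] a1 by (simp add: cshift_def p_def [symmetric])
      define e where "e = w (p + int n)"
      have e: "e = w p + int n" using shift_equivariantD [OF w] by (simp add: e_def)
      have eF: "e \<in> F" using F(2) p by (auto simp: e_def)
      have be: "?G e (bend C k) = w (bend ?P k)" if k: "a \<le> k" "k \<le> a + int n" for k
      proof -
        let ?j = "bend C k"
        have j: "k \<le> ?j" "?j \<notin> C" using bend_ge bend_notin [OF gapC] by auto
        have jn: "?j \<le> a + int n" using bend_between [of k "a + int n" C] C k by force
        show ?thesis
        proof (cases "?j = a + int n")
          case True
          \<comment> \<open>A block reaching \<open>a + n\<close> continues into the next period,
            where it ends at \<open>p + n\<close>; the carrier written at \<open>a + n\<close>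
            equals the value of \<open>w\<close> there.\<close>
          have "bend ?P k = p + int n"
          proof (rule bend_eqI)
            show "k \<le> p + int n" using k p by simp
            show "p + int n \<notin> ?P" using p inP [of p] by (simp add: per_add_period)
            fix i assume i: "k \<le> i" "i < p + int n"
            show "i \<in> ?P"
            proof (cases "i < a + int n")
              case l: True
              then have "i \<in> C" using bend_between [of k i C] i True by simp
              then show ?thesis using inP C by blast
            next
              case l: False
              then have "i - int n \<in> C" using bend_between [of a "i - int n" C] i by (simp add: p_def)
              then have "i - int n \<in> ?P" using inP C by blast
              then show ?thesis using per_add_period [of "i - int n" n] by simp
            qed
          qed
          then show ?thesis using True by (simp add: e_def)
        next
          case False
          then have jW: "?j \<in> ?W" using j jn k by auto
          have "bend ?P k = ?j"
          proof (rule bend_eqI)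
            fix i assume "k \<le> i" "i < ?j"
            then show "i \<in> ?P" using bend_between [of k i C] inP C by blast
          qed (use j inP [OF jW] in auto)
          then show ?thesis using False jW g0 by simp
        qed
      qed
      have asc: "ascending (?G e) C \<longleftrightarrow> ascending w ?P"
      proof -
        have "?P \<inter> ?W = C" using inP C by blast
        moreover have "?G e k = w k" if "k \<in> C" for k using that C g0 by auto
        moreover have "?G e (bend C k) = w (bend ?P k)" if "k \<in> C" for k using that C by (intro be) auto
        ultimately show ?thesis
          unfolding ascending_per_window [OF gapP n w, of a] by (simp add: ascending_def)
      qed
      have \<Phi>: "\<Phi> (?G e \<circ> cshift C) = \<Psi> (w \<circ> cshift ?P)"
      proof (rule dep)
        fix k assume k: "a < k" "k \<le> a + int n"
        then have "k - 1 \<in> ?W" by simp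
        then show "(?G e \<circ> cshift C) k = (w \<circ> cshift ?P) k"
          using inP be [of k] k g0 [of "k - 1"] by (simp add: cshift_def split: if_splits)
      next
        fix j assume j: "j > a + int n"
        then have "j \<notin> C" "j - 1 \<notin> C" using C by auto
        then show "(?G e \<circ> cshift C) j = g0 j" using j by (simp add: cshift_def bend_outside)
      qed
      have "inj_on ?\<rho> C" using bij C by (auto simp: bij_betw_def intro: inj_on_subset)
      then have card: "card (?\<rho> ` C) = card C" by (rule card_image)
      have "(\<Sum>e'\<in>F. ?L e' C) = (\<Sum>e'\<in>F. if e' = e then ?L e C else 0)"
        by (rule sum.cong) (use pa e in auto)
      also have "\<dots> = ?L e C" using F(1) eF by simp
      also have "\<dots> = ?R (?\<rho> ` C)" using pa e asc \<Phi> card by simp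
      finally show ?thesis using ps by simp
    qed
  qed
  have "(\<Sum>e\<in>F. row a n x (\<lambda>g. if g a = e - int n then \<Phi> g else 0) (g0(a + int n := e))) =
      (\<Sum>e\<in>F. \<Sum>C\<in>Pow ?W. ?L e C)"
    unfolding row_expand ..
  also have "\<dots> = (\<Sum>C\<in>Pow ?W. \<Sum>e\<in>F. ?L e C)" by (rule sum.swap)
  also have "\<dots> = (\<Sum>C\<in>Pow ?W. if ?\<rho> ` C \<subset> {0..<n} then ?R (?\<rho> ` C) else 0)"
    by (rule sum.cong [OF refl], rule key) simp
  also have "\<dots> = (\<Sum>A\<in>Pow {0..<n}. if A \<subset> {0..<n} then ?R A else 0)"
    by (rule sum.reindex_bij_betw [OF bij_betw_Pow [OF bij]])
  also have "\<dots> = (\<Sum>A\<in>{A. A \<subset> {0..<n}}. ?R A)"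
    by (rule sum.mono_neutral_cong_right) auto
  finally show ?thesis .
qed

text \<open>The hypothesis says that T and T' are conjugate by 1 + c u, with u the nilCoxeter generator on
  pairs; for each unordered pair {e, f} this is an identity of traces of 2 by 2 matrices.\<close>

lemma pair_matrix_trace:
  fixes T T' :: "int \<Rightarrow> int \<Rightarrow> int \<Rightarrow> int \<Rightarrow> 'a::{idom,ring_char_0}"
  assumes F: "finite F"
    and ex: "\<And>e f p q. T e f p q + (if e < f then c * T f e p q else 0) =
      T' e f p q + (if q < p then c * T' e f q p else 0)"
  shows "(\<Sum>e\<in>F. \<Sum>f\<in>F. T e f (e - s) (f - s)) = (\<Sum>e\<in>F. \<Sum>f\<in>F. T' e f (e - s) (f - s))"
proof -
  define d where "d e f = T e f (e - s) (f - s) - T' e f (e - s) (f - s)" for e f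
  \<comment> \<open>By the first two instances of \<open>ex\<close>, the differences are
    \<open>- c\<close> times an off-diagonal entry of \<open>T\<close> and \<open>c\<close> times
    the same entry of \<open>T'\<close>; by the third instance these two entries agree.\<close>
  have lt: "d e f = - d f e" if "e < f" for e f
    using ex [of e f "e - s" "f - s"] ex [of f e "f - s" "e - s"] ex [of f e "e - s" "f - s"] that
    by (simp add: d_def algebra_simps)
  have eq: "d e e = 0" for e using ex [of e e "e - s" "e - s"] by (simp add: d_def)
  have anti: "d e f = - d f e" for e f
    using lt [of e f] lt [of f e] eq [of e] by (cases e f rule: linorder_cases) auto
  have "(\<Sum>e\<in>F. \<Sum>f\<in>F. d e f) = (\<Sum>e\<in>F. \<Sum>f\<in>F. - d f e)" by (simp add: anti [symmetric])
  also have "\<dots> = - (\<Sum>e\<in>F. \<Sum>f\<in>F. d f e)" by (simp add: sum_negf)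
  also have "(\<Sum>e\<in>F. \<Sum>f\<in>F. d f e) = (\<Sum>e\<in>F. \<Sum>f\<in>F. d e f)" by (rule sum.swap)
  finally have "2 * (\<Sum>e\<in>F. \<Sum>f\<in>F. d e f) = 0" by simp
  then have "(\<Sum>e\<in>F. \<Sum>f\<in>F. d e f) = 0" by simp
  then show ?thesis by (simp add: d_def sum_subtractf)
qed

section \<open>Cyclically decreasing words and proper sets of residues\<close>

definition cyc_ordered :: "nat \<Rightarrow> nat list \<Rightarrow> bool" where
  "cyc_ordered n ws \<longleftrightarrow>
     (\<forall>p q. p < length ws \<longrightarrow> q < length ws \<longrightarrow> ws ! q = (ws ! p + 1) mod n \<longrightarrow> q < p)"

lemma cyc_ordered_Cons:
  "cyc_ordered n (k # ws) \<longleftrightarrow>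
     cyc_ordered n ws \<and> (k + 1) mod n \<notin> set ws \<and> (k + 1) mod n \<noteq> k"
proof
  assume L: "cyc_ordered n (k # ws)"
  show "cyc_ordered n ws \<and> (k + 1) mod n \<notin> set ws \<and> (k + 1) mod n \<noteq> k"
  proof (intro conjI)
    show "cyc_ordered n ws"
      unfolding cyc_ordered_def
    proof (intro allI impI)
      fix p q assume "p < length ws" "q < length ws" "ws ! q = (ws ! p + 1) mod n"
      then show "q < p" using L [unfolded cyc_ordered_def, rule_format, of "Suc p" "Suc q"] by simp
    qed
    show "(k + 1) mod n \<notin> set ws"
    proof
      assume "(k + 1) mod n \<in> set ws"
      then obtain q where "q < length ws" "ws ! q = (k + 1) mod n" by (auto simp: in_set_conv_nth)
      then show False using L [unfolded cyc_ordered_def, rule_format, of 0 "Suc q"] by simp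
    qed
    show "(k + 1) mod n \<noteq> k"
      using L [unfolded cyc_ordered_def, rule_format, of 0 0] by auto
  qed
next
  assume R: "cyc_ordered n ws \<and> (k + 1) mod n \<notin> set ws \<and> (k + 1) mod n \<noteq> k"
  show "cyc_ordered n (k # ws)" unfolding cyc_ordered_def
  proof (intro allI impI)
    fix p q assume pq: "p < length (k # ws)" "q < length (k # ws)" "(k # ws) ! q = ((k # ws) ! p + 1) mod n"
    show "q < p"
    proof (cases p)
      case 0
      then show ?thesis using pq R by (cases q) (auto simp: in_set_conv_nth)
    next
      case (Suc p')
      then show ?thesis using pq R by (cases q) (auto simp: cyc_ordered_def)
    qed
  qed
qed

lemma cyc_dec_iff_ordered:
  "cyc_dec n v \<longleftrightarrow> (\<exists>ws. set ws \<subseteq> {0..<n} \<and> distinct ws \<and> word_prod n ws = v \<and>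
      length ws = alen n v \<and> cyc_ordered n ws)"
  by (simp add: cyc_dec_def cyc_ordered_def)

context
  fixes n :: nat
  assumes n2: "n \<ge> 2"
begin

lemma Suc_mod_neq: "k < n \<Longrightarrow> (k + 1) mod n \<noteq> k"
  using n2 by (cases "k + 1 = n") auto

lemma in_per: "k \<in> per n A \<longleftrightarrow> (\<exists>r\<in>A. k mod int n = int r)"
proof -
  have "k mod int n \<ge> 0" using n2 by simp
  then show ?thesis by (metis mem_Collect_eq nat_int per_def int_nat_eq)
qed

lemma in_per_Suc: "k mod int n = int r \<Longrightarrow> k + 1 \<in> per n A \<longleftrightarrow> (r + 1) mod n \<in> A"
proof -
  assume "k mod int n = int r"
  then have "(k + 1) mod int n = int ((r + 1) mod n)"
    by (metis mod_add_left_eq of_nat_1 of_nat_add zmod_int)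
  then show ?thesis by (auto simp: in_per)
qed

lemma sref_eq_swp: "k < n \<Longrightarrow> sref n k = swp (per n {k})"
  by (auto simp: fun_eq_iff sref_eq [OF n2] swp_def in_per)

text \<open>The cyclic successor of the first letter occurs nowhere in the word, so the letters
  never exhaust the residues.\<close>

lemma cyc_ordered_psubset:
  assumes "set ws \<subseteq> {0..<n}" "cyc_ordered n ws"
  shows "set ws \<subset> {0..<n}"
proof (cases ws)
  case Nil
  then show ?thesis using n2 by auto
next
  case (Cons k vs)
  then have "(k + 1) mod n \<notin> set ws" "(k + 1) mod n < n" using assms n2 by (auto simp: cyc_ordered_Cons)
  then show ?thesis using assms(1) by auto
qed

text \<open>Prepending \<open>k\<close> adjoins its residue class; neither \<open>k\<close> nor its
  successor occurs in the rest, which is the isolation required by \<open>cshift_Un\<close> and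
  \<open>ascending_Un\<close>.\<close>

lemma cyc_word:
  assumes "set ws \<subseteq> {0..<n}" "distinct ws" "cyc_ordered n ws"
  shows "word_prod n ws = cshift (per n (set ws))"
    and "affine_perm n w \<Longrightarrow>
      alen n (w \<circ> word_prod n ws) = alen n w + length ws \<longleftrightarrow> ascending w (per n (set ws))"
proof -
  have "word_prod n ws = cshift (per n (set ws)) \<and> (\<forall>w. affine_perm n w \<longrightarrow>
      (alen n (w \<circ> word_prod n ws) = alen n w + length ws \<longleftrightarrow> ascending w (per n (set ws))))"
    using assms
  proof (induction ws)
    case Nil
    have "per n {} = {}" by (simp add: per_def)
    then show ?case by (simp add: word_prod_Nil [OF n2] cshift_empty ascending_def)
  next
    case (Cons k ws)
    let ?A = "per n (set ws)" and ?K = "per n {k}"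
    have k: "k < n" "k \<notin> set ws" "(k + 1) mod n \<notin> set ws" using Cons.prems by (auto simp: cyc_ordered_Cons)
    have IH: "word_prod n ws = cshift ?A \<and> (\<forall>w. affine_perm n w \<longrightarrow>
        (alen n (w \<circ> word_prod n ws) = alen n w + length ws \<longleftrightarrow> ascending w ?A))"
      by (rule Cons.IH) (use Cons.prems in \<open>auto simp: cyc_ordered_Cons\<close>)
    note IH1 = IH [THEN conjunct1] and IH2 = IH [THEN conjunct2, rule_format]
    have gap: "gappy ?A"
      using Cons.prems by (intro gappy_per_psubset cyc_ordered_psubset) (auto simp: cyc_ordered_Cons)
    have disj: "i \<in> ?K \<Longrightarrow> i \<notin> ?A \<and> i + 1 \<notin> ?A \<and> i + 1 \<notin> ?K" for i
      using k Suc_mod_neq [of k] in_per_Suc [of i k] by (auto simp: in_per [of i])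
    have un: "per n (set (k # ws)) = ?A \<union> ?K" by (auto simp: per_def)
    note s = sref_eq_swp [OF k(1)]
    have 1: "word_prod n (k # ws) = cshift (per n (set (k # ws)))"
      unfolding un word_prod_Cons [OF n2] IH1 s by (rule cshift_Un [symmetric, OF gap]) (rule disj)
    have 2: "alen n (w \<circ> word_prod n (k # ws)) = alen n w + length (k # ws) \<longleftrightarrow> ascending w (per n (set (k # ws)))"
      if w: "affine_perm n w" for w
    proof -
      have w': "affine_perm n (w \<circ> sref n k)" by (rule affine_perm_sref [OF n2 k(1) w])
      have assoc: "w \<circ> word_prod n (k # ws) = (w \<circ> sref n k) \<circ> word_prod n ws"
        by (simp only: word_prod_Cons [OF n2] comp_assoc)
      \<comment> \<open>The remaining letters add at most their number, so additivity for the whole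
        word forces an ascent at the first letter as well.\<close>
      have le: "alen n ((w \<circ> sref n k) \<circ> word_prod n ws) \<le> alen n (w \<circ> sref n k) + length ws"
        using Cons.prems by (intro alen_comp_word_le [OF n2 w']) auto
      have asc: "(\<forall>i\<in>?K. w i < w (i + 1)) \<longleftrightarrow> w (int k) < w (int k + 1)"
      proof
        assume up: "w (int k) < w (int k + 1)"
        show "\<forall>i\<in>?K. w i < w (i + 1)"
        proof
          fix i assume "i \<in> ?K"
          then have i: "i = int k + int n * (i div int n)" by (simp add: in_per) (metis mod_mult_div_eq)
          have "w i = w (int k) + int n * (i div int n)"
            using affine_perm_period_mult [OF n2 w, of "int k" "i div int n"] i by simp
          moreover have "w (i + 1) = w (int k + 1) + int n * (i div int n)"
            using affine_perm_period_mult [OF n2 w, of "int k + 1" "i div int n"] i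
            by (metis add.assoc add.commute)
          ultimately show "w i < w (i + 1)" using up by simp
        qed
      qed (use k in \<open>auto simp: in_per\<close>)
      have "ascending w (?A \<union> ?K) \<longleftrightarrow> (\<forall>i\<in>?K. w i < w (i + 1)) \<and> ascending (w \<circ> swp ?K) ?A"
        by (rule ascending_Un [OF gap]) (rule disj)
      then show ?thesis
        unfolding un asc s [symmetric] IH2 [OF w', symmetric] assoc
        using le alen_sref [OF n2 k(1) w] by auto
    qed
    from 1 2 show ?case by blast
  qed
  then show "word_prod n ws = cshift (per n (set ws))"
    and "affine_perm n w \<Longrightarrow>
      alen n (w \<circ> word_prod n ws) = alen n w + length ws \<longleftrightarrow> ascending w (per n (set ws))" by auto
qed

text \<open>A nonempty proper set of residues is not closed under the cyclic successor, so some
  \<open>k\<close> in it has its successor outside; such a \<open>k\<close> may come first.\<close>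

lemma ex_cyc_word:
  assumes "A \<subset> {0..<n}"
  shows "\<exists>ws. set ws = A \<and> distinct ws \<and> cyc_ordered n ws"
  using assms
proof (induction "card A" arbitrary: A rule: less_induct)
  case less
  show ?case
  proof (cases "A = {}")
    case True
    then show ?thesis by (auto simp: cyc_ordered_def)
  next
    case False
    have "\<exists>k\<in>A. (k + 1) mod n \<notin> A"
    proof (rule ccontr)
      assume closed: "\<not> ?thesis"
      obtain a where a: "a \<in> A" using False by blast
      have all: "(a + d) mod n \<in> A" for d
      proof (induction d)
        case 0
        then show ?case using a less.prems by auto
      next
        case (Suc d)
        then have "((a + d) mod n + 1) mod n \<in> A" using closed by blast
        then show ?case by (simp add: mod_simps)
      qed
      have "r \<in> A" if "r < n" for r
      proof -
        have "a < n" using a less.prems by auto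
        then have "(a + (r + n - a)) mod n = r" using that by simp
        then show ?thesis using all [of "r + n - a"] by simp
      qed
      then show False using less.prems by auto
    qed
    then obtain k where k: "k \<in> A" "(k + 1) mod n \<notin> A" by blast
    have "finite A" using less.prems finite_subset by blast
    then have "card (A - {k}) < card A" by (intro card_Diff1_less k(1))
    then obtain ws where ws: "set ws = A - {k}" "distinct ws" "cyc_ordered n ws"
      using less.hyps [of "A - {k}"] less.prems by blast
    have "set (k # ws) = A" using k(1) ws(1) by (simp add: insert_absorb)
    moreover have "distinct (k # ws)" using ws(1,2) by simp
    moreover have "(k + 1) mod n \<noteq> k" using k by metis
    then have "cyc_ordered n (k # ws)" using ws(1,3) k(2) by (simp add: cyc_ordered_Cons)
    ultimately show ?thesis by blast
  qed
qed

lemma cshift_per: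
  assumes A: "A \<subset> {0..<n}"
  shows "affine_perm n (cshift (per n A))" "alen n (cshift (per n A)) = card A" "cyc_dec n (cshift (per n A))"
proof -
  obtain ws where ws: "set ws = A" "distinct ws" "cyc_ordered n ws" using ex_cyc_word [OF A] by blast
  have sub: "set ws \<subseteq> {0..<n}" using ws A by auto
  have eq: "word_prod n ws = cshift (per n A)" using cyc_word(1) [OF sub ws(2,3)] ws(1) by simp
  show aff: "affine_perm n (cshift (per n A))" using affine_perm_word_prod [OF n2 sub] eq by simp
  have "k < bend (per n A) k" if "k \<in> per n A" for k
    using that bend_ge [of k "per n A"] bend_notin [OF gappy_per_psubset [OF A], of k] by (cases "bend (per n A) k = k") auto
  then have "ascending id (per n A)" by (simp add: ascending_def)
  then have "alen n (id \<circ> word_prod n ws) = alen n id + length ws"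
    using cyc_word(2) [OF sub ws(2,3) affine_perm_id [OF n2]] ws(1) by simp
  then have len: "alen n (cshift (per n A)) = length ws" by (simp add: eq alen_id [OF n2])
  then show "alen n (cshift (per n A)) = card A" using ws distinct_card by metis
  show "cyc_dec n (cshift (per n A))"
    unfolding cyc_dec_iff_ordered using sub ws eq len by metis
qed

lemma alen_comp_cshift:
  assumes A: "A \<subset> {0..<n}" and w: "affine_perm n w"
  shows "alen n (w \<circ> cshift (per n A)) = alen n w + card A \<longleftrightarrow> ascending w (per n A)"
proof -
  obtain ws where ws: "set ws = A" "distinct ws" "cyc_ordered n ws" using ex_cyc_word [OF A] by blast
  have sub: "set ws \<subseteq> {0..<n}" using ws A by auto
  show ?thesis using cyc_word [OF sub ws(2,3)] w ws(1,2) distinct_card by metis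
qed

text \<open>The proper subsets of the residues are the index set of the sum in
  \<open>row_trace\<close>, so that sum runs over the cyclically decreasing elements.\<close>

lemma cyc_dec_iff: "cyc_dec n v \<longleftrightarrow> (\<exists>A. A \<subset> {0..<n} \<and> v = cshift (per n A))"
proof
  assume "cyc_dec n v"
  then obtain ws where "set ws \<subseteq> {0..<n}" "distinct ws" "word_prod n ws = v" "cyc_ordered n ws"
    unfolding cyc_dec_iff_ordered by blast
  then show "\<exists>A. A \<subset> {0..<n} \<and> v = cshift (per n A)"
    using cyc_word(1) cyc_ordered_psubset by metis
qed (use cshift_per in blast)

lemma cshift_per_inj: "inj_on (\<lambda>A. cshift (per n A)) {A. A \<subset> {0..<n}}"
proof (rule inj_onI)
  fix A B assume AB: "A \<in> {A. A \<subset> {0..<n}}" "B \<in> {A. A \<subset> {0..<n}}" and eq: "cshift (per n A) = cshift (per n B)"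
  \<comment> \<open>The set can be recovered from its shift: for \<open>k\<close> outside
    \<open>P\<close> the value at \<open>k + 1\<close> is a block end, hence at least
    \<open>k + 1\<close>.\<close>
  have mem: "k \<in> P \<longleftrightarrow> cshift P (k + 1) = k" for P k
    using bend_ge [of "k + 1" P] by (auto simp: cshift_def)
  have "per n A = per n B" using mem eq by (auto simp: set_eq_iff)
  moreover have "r \<in> S \<longleftrightarrow> int r \<in> per n S" if "r < n" for r S using that by (simp add: per_def)
  ultimately have "r \<in> A \<longleftrightarrow> r \<in> B" if "r < n" for r using that by simp
  then show "A = B" using AB by auto
qed

section \<open>Products of two cyclically decreasing elements\<close>

definition factor_pairs :: "(int \<Rightarrow> int) \<Rightarrow> (nat set \<times> nat set) set" where
  "factor_pairs z = {(A, B). A \<subset> {0..<n} \<and> B \<subset> {0..<n} \<and> cshift (per n A) \<circ> cshift (per n B) = z \<and>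
     card A + card B = alen n z}"

lemma finite_proper_subsets: "finite {A. A \<subset> {0..<n}}"
  by (rule finite_subset [of _ "Pow {0..<n}"]) auto

lemma finite_factor_pairs: "finite (factor_pairs z)"
  by (rule finite_subset [of _ "{A. A \<subset> {0..<n}} \<times> {A. A \<subset> {0..<n}}"])
    (auto simp: factor_pairs_def finite_proper_subsets)

lemma equivariant_eqI:
  assumes "shift_equivariant n f" "shift_equivariant n g" "\<forall>k\<in>{a..<a + int n}. f k = g k"
  shows "f = g"
proof
  fix k
  let ?r = "a + (k - a) mod int n" and ?q = "(k - a) div int n"
  have k: "k = ?r + int n * ?q" by simp
  have "?r \<in> {a..<a + int n}" using n2 by simp
  then have "f ?r = g ?r" using assms(3) by blast
  then show "f k = g k" by (subst (1 2) k) (simp only: periodic_mult [OF assms(1)] periodic_mult [OF assms(2)])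
qed

text \<open>Two staggered passes start from the identity: one carrier enters at \<open>n\<close> and
  leaves at 0, the other enters at \<open>n + 1\<close> and leaves at 1, and the product is read at
  \<open>2, ..., n + 1\<close>. \<open>T\<close> is the transfer matrix from incoming to outgoing
  pairs, with the generating function as its twisted trace.\<close>

lemma factor_pairs_symmetric:
  fixes x y :: "'a::{idom,ring_char_0}"
  assumes z: "affine_perm n z"
  shows "(\<Sum>(A, B)\<in>factor_pairs z. x ^ card A * y ^ card B) = (\<Sum>(A, B)\<in>factor_pairs z. y ^ card A * x ^ card B)"
proof -
  \<comment> \<open>Incoming carriers are entries of \<open>id\<close> on \<open>{n..<2 * n}\<close>
    or of a shift on \<open>{n + 1..<2 * n + 1}\<close>. A shift looks ahead by less than
    \<open>n\<close>, whence the bound \<open>3 * n\<close>.\<close>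
  let ?F = "{0..3 * int n}" and ?N = "int n"
  let ?W = "\<lambda>e f. id(?N := e, ?N + 1 := f)"
  let ?z = "\<lambda>g. if \<forall>k\<in>{2..?N + 1}. g k = z k then 1 else 0 :: 'a"
  let ?\<phi> = "\<lambda>p q g. if g 0 = p then if g 1 = q then ?z g else 0 else 0"
  define T where "T x y e f p q = row 0 n x (row 1 n y (?\<phi> p q)) (?W e f)" for x y :: 'a and e f p q
  \<comment> \<open>Site 0 exchanges only the two outgoing carriers, so \<open>hop 0\<close> acts on
    the pair \<open>p\<close>, \<open>q\<close> and leaves the test \<open>?z\<close> alone.\<close>
  have hop0: "hop 0 c (?\<phi> p q) = (\<lambda>g. ?\<phi> p q g + (if q < p then c else 0) * ?\<phi> q p g)" for c p q
  proof
    fix g :: "int \<Rightarrow> int"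
    have "(g \<circ> swp {0}) k = g k" if "k \<in> {2..?N + 1}" for k using that by (simp add: swp_def)
    then have "?z (g \<circ> swp {0}) = ?z g" by simp
    moreover have "(g \<circ> swp {0}) 0 = g 1" "(g \<circ> swp {0}) 1 = g 0" by (simp_all add: swp_def)
    ultimately show "hop 0 c (?\<phi> p q) g = ?\<phi> p q g + (if q < p then c else 0) * ?\<phi> q p g"
      unfolding hop_def by auto
  qed
  \<comment> \<open>This is \<open>row_exchange\<close> over a whole period: its factor at site
    \<open>n\<close> acts on the incoming pair, its factor at site 0 on the outgoing one.\<close>
  have exch: "T x y e f p q + (if e < f then (x - y) * T x y f e p q else 0) =
      T y x e f p q + (if q < p then (x - y) * T y x e f q p else 0)" for x y e f p q
  proof -
    have "hop ?N (x - y) (row 0 n x (row 1 n y (?\<phi> p q))) (?W e f) =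
        row 0 n y (row 1 n x (hop 0 (x - y) (?\<phi> p q))) (?W e f)"
      using row_exchange [of 0 n x y "?\<phi> p q"] by simp
    moreover have W: "?W e f \<circ> swp {?N} = ?W f e" "?W e f ?N = e" "?W e f (?N + 1) = f"
      by (auto simp: fun_eq_iff swp_def)
    have "hop ?N (x - y) (row 0 n x (row 1 n y (?\<phi> p q))) (?W e f) =
        T x y e f p q + (if e < f then (x - y) * T x y f e p q else 0)"
      unfolding T_def by (simp only: hop_def W)
    moreover have "row 0 n y (row 1 n x (hop 0 (x - y) (?\<phi> p q))) (?W e f) =
        T y x e f p q + (if q < p then x - y else 0) * T y x e f q p"
      unfolding T_def hop0 row_lincomb ..
    ultimately show ?thesis by (cases "q < p") simp_all
  qed
  have main: "(\<Sum>e\<in>?F. \<Sum>f\<in>?F. T x y e f (e - ?N) (f - ?N)) =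
      (\<Sum>(A, B)\<in>factor_pairs z. x ^ card A * y ^ card B)" for x y :: 'a
  proof -
    \<comment> \<open>\<open>\<Phi> f\<close> is the second pass with its guard;
      \<open>\<Psi> f\<close> expresses it through the output of the first pass, with the carrier
      \<open>f\<close> written back at \<open>n + 1\<close>.\<close>
    define \<Phi> where "\<Phi> f = row 1 n y (\<lambda>g. if g 1 = f - ?N then ?z g else 0)" for f
    define \<Psi> where "\<Psi> f v = \<Phi> f (v(?N + 1 := f))" for f v
    let ?S = "{A. A \<subset> {0..<n}}"
    let ?c = "\<lambda>A. cshift (per n A)"
    have Tguard: "T x y e f p (f - ?N) = row 0 n x (\<lambda>g. if g 0 = p then \<Phi> f g else 0) (id(?N + 1 := f, 0 + ?N := e))" for e f p
    proof -
      have "row 1 n y (?\<phi> p (f - ?N)) = (\<lambda>g. if g 0 = p then \<Phi> f g else 0)"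
        unfolding \<Phi>_def by (rule row_guard) simp
      moreover have "?W e f = id(?N + 1 := f, 0 + ?N := e)" by (auto simp: fun_eq_iff)
      ultimately show ?thesis unfolding T_def by simp
    qed
    have step1: "(\<Sum>e\<in>?F. T x y e f (e - ?N) (f - ?N)) =
        (\<Sum>A\<in>?S. if ascending id (per n A) then x ^ card A * \<Psi> f (id \<circ> ?c A) else 0)" for f
      unfolding Tguard
    proof (rule row_trace)
      show "id ` {0 + ?N..<0 + 2 * ?N} \<subseteq> ?F" by auto
      fix g v :: "int \<Rightarrow> int"
      assume g: "\<And>k. 0 < k \<Longrightarrow> k \<le> 0 + ?N \<Longrightarrow> g k = v k"
        and j: "\<And>j. 0 + ?N < j \<Longrightarrow> g j = (id(?N + 1 := f)) j"
      show "\<Phi> f g = \<Psi> f v" unfolding \<Psi>_def \<Phi>_def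
      proof (rule row_cong [where S = "{1..?N + 1}"])
        fix k assume "k \<in> {1..?N + 1}"
        then show "g k = (v(?N + 1 := f)) k" using g [of k] j [of k] by (cases "k = ?N + 1") auto
      next
        fix g g' :: "int \<Rightarrow> int" assume "\<And>k. k \<in> {1..?N + 1} \<Longrightarrow> g k = g' k"
        then show "(if g 1 = f - ?N then ?z g else 0) = (if g' 1 = f - ?N then ?z g' else 0)" by simp
      qed auto
    qed (use n2 in \<open>auto simp: shift_equivariant_def\<close>)
    have step2: "(\<Sum>f\<in>?F. \<Psi> f (?c A)) = (\<Sum>B\<in>?S. if ascending (?c A) (per n B) then y ^ card B * ?z (?c A \<circ> ?c B) else 0)"
      if A: "A \<in> ?S" for A
    proof -
      have "\<Psi> f (?c A) = row 1 n y (\<lambda>g. if g 1 = f - ?N then ?z g else 0) ((?c A)(1 + ?N := f))" for f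
        by (simp add: \<Psi>_def \<Phi>_def add.commute)
      then have "(\<Sum>f\<in>?F. \<Psi> f (?c A)) = (\<Sum>f\<in>?F. row 1 n y (\<lambda>g. if g 1 = f - ?N then ?z g else 0) ((?c A)(1 + ?N := f)))"
        by simp
      also have "\<dots> = (\<Sum>B\<in>?S. if ascending (?c A) (per n B) then y ^ card B * ?z (?c A \<circ> ?c B) else 0)"
      proof (rule row_trace)
        show eqv: "shift_equivariant n (?c A)" using A cshift_per(1) affine_perm_equivariant [OF n2] by blast
        show "?c A ` {1 + ?N..<1 + 2 * ?N} \<subseteq> ?F"
        proof
          fix j assume "j \<in> ?c A ` {1 + ?N..<1 + 2 * ?N}"
          then obtain k where k: "k \<in> {1 + ?N..<1 + 2 * ?N}" "j = ?c A k" by blast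
          obtain r where r: "r < n" "r \<notin> A" using A psubset_imp_ex_mem [of A "{0..<n}"] by auto
          have "bend (per n A) k < k + ?N"
          proof (rule ccontr)
            assume "\<not> ?thesis"
            moreover have "0 \<le> (int r - k) mod ?N" "(int r - k) mod ?N < ?N" using n2 by simp_all
            ultimately have "k + (int r - k) mod ?N \<in> per n A"
              by (intro bend_between [of k]) linarith+
            moreover have "(k + (int r - k) mod ?N) mod ?N = int r" using r by (simp add: mod_simps)
            ultimately show False using r by (simp add: per_def)
          qed
          then show "j \<in> ?F" using k bend_ge [of k "per n A"] by (auto simp: cshift_def)
        qed
        fix g v :: "int \<Rightarrow> int" assume "\<And>k. 1 < k \<Longrightarrow> k \<le> 1 + ?N \<Longrightarrow> g k = v k"
        then show "?z g = ?z v" by simp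
      qed (use n2 in auto)
      finally show ?thesis .
    qed
    have asc_id: "ascending id (per n A)" if "A \<in> ?S" for A
      using that alen_comp_cshift [of A id] cshift_per(2) affine_perm_id [OF n2] alen_id [OF n2] by simp
    have z1: "ascending (?c A) (per n B) \<and> (\<forall>k\<in>{2..?N + 1}. (?c A \<circ> ?c B) k = z k) \<longleftrightarrow> (A, B) \<in> factor_pairs z"
      if AB: "A \<in> ?S" "B \<in> ?S" for A B
    proof -
      have ps: "A \<subset> {0..<n}" "B \<subset> {0..<n}" using AB by simp_all
      note aff = cshift_per(1) [OF ps(1)] affine_perm_comp [OF n2 cshift_per(1) [OF ps(1)] cshift_per(1) [OF ps(2)]]
      have "{2..?N + 1} = {2..<2 + ?N}" by auto
      then have "(\<forall>k\<in>{2..?N + 1}. (?c A \<circ> ?c B) k = z k) \<longleftrightarrow> ?c A \<circ> ?c B = z"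
        using equivariant_eqI [OF affine_perm_equivariant [OF n2 aff(2)] affine_perm_equivariant [OF n2 z], of 2] by auto
      moreover have "ascending (?c A) (per n B) \<longleftrightarrow> alen n (?c A \<circ> ?c B) = card A + card B"
        using alen_comp_cshift [OF ps(2) aff(1)] cshift_per(2) [OF ps(1)] by simp
      ultimately show ?thesis using ps by (auto simp: factor_pairs_def)
    qed
    have "(\<Sum>e\<in>?F. \<Sum>f\<in>?F. T x y e f (e - ?N) (f - ?N)) = (\<Sum>f\<in>?F. \<Sum>e\<in>?F. T x y e f (e - ?N) (f - ?N))"
      by (rule sum.swap)
    also have "\<dots> = (\<Sum>f\<in>?F. \<Sum>A\<in>?S. x ^ card A * \<Psi> f (?c A))"
      unfolding step1 by (intro sum.cong refl) (simp add: asc_id)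
    also have "\<dots> = (\<Sum>A\<in>?S. \<Sum>f\<in>?F. x ^ card A * \<Psi> f (?c A))" by (rule sum.swap)
    also have "\<dots> = (\<Sum>A\<in>?S. x ^ card A * (\<Sum>B\<in>?S. if ascending (?c A) (per n B) then y ^ card B * ?z (?c A \<circ> ?c B) else 0))"
      by (intro sum.cong refl) (simp add: step2 sum_distrib_left [symmetric])
    also have "\<dots> = (\<Sum>A\<in>?S. \<Sum>B\<in>?S. if (A, B) \<in> factor_pairs z then x ^ card A * y ^ card B else 0)"
      unfolding sum_distrib_left by (intro sum.cong refl) (use z1 in auto)
    also have "\<dots> = (\<Sum>(A, B)\<in>?S \<times> ?S. if (A, B) \<in> factor_pairs z then x ^ card A * y ^ card B else 0)"
      by (rule sum.cartesian_product)
    also have "\<dots> = (\<Sum>(A, B)\<in>factor_pairs z. x ^ card A * y ^ card B)"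
    proof (rule sum.mono_neutral_cong_right)
      show "factor_pairs z \<subseteq> ?S \<times> ?S" by (auto simp: factor_pairs_def)
    qed (auto simp: finite_proper_subsets)
    finally show ?thesis .
  qed
  show ?thesis
    unfolding main [symmetric] by (rule pair_matrix_trace [OF _ exch]) simp
qed

text \<open>Since card A + card B is constant on the factorizations of z, comparing coefficients at
  y = 1 suffices.\<close>

lemma card_factor_pairs_swap:
  assumes "affine_perm n z" "alen n z = a + b"
  shows "card {(A, B). (A, B) \<in> factor_pairs z \<and> card A = a \<and> card B = b} =
    card {(A, B). (A, B) \<in> factor_pairs z \<and> card A = b \<and> card B = a}"
proof -
  let ?E = "factor_pairs z"
  have sum: "card A + card B = a + b" if "(A, B) \<in> ?E" for A B
    using that assms by (simp add: factor_pairs_def)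
  have cnt: "coeff (\<Sum>(A, B)\<in>?E. monom (1::int) (f A B)) a = int (card {(A, B). (A, B) \<in> ?E \<and> f A B = a})" for f
  proof -
    have "coeff (\<Sum>(A, B)\<in>?E. monom (1::int) (f A B)) a = (\<Sum>p\<in>?E. if case p of (A, B) \<Rightarrow> f A B = a then 1 else 0)"
      by (simp add: coeff_sum case_prod_unfold)
    also have "\<dots> = int (card (?E \<inter> {p. case p of (A, B) \<Rightarrow> f A B = a}))"
      by (subst sum.If_cases) (simp_all add: finite_factor_pairs)
    also have "?E \<inter> {p. case p of (A, B) \<Rightarrow> f A B = a} = {(A, B). (A, B) \<in> ?E \<and> f A B = a}" by auto
    finally show ?thesis .
  qed
  have "(\<Sum>(A, B)\<in>?E. monom (1::int) (card A)) = (\<Sum>(A, B)\<in>?E. monom (1::int) (card B))"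
    using factor_pairs_symmetric [OF assms(1), of "monom (1::int) 1" 1] by (simp add: monom_power)
  then have "card {(A, B). (A, B) \<in> ?E \<and> card A = a} = card {(A, B). (A, B) \<in> ?E \<and> card B = a}"
    using cnt [of "\<lambda>A B. card A"] cnt [of "\<lambda>A B. card B"] by simp
  moreover have "{(A, B). (A, B) \<in> ?E \<and> card A = a} = {(A, B). (A, B) \<in> ?E \<and> card A = a \<and> card B = b}"
    "{(A, B). (A, B) \<in> ?E \<and> card B = a} = {(A, B). (A, B) \<in> ?E \<and> card A = b \<and> card B = a}"
    using sum by force+
  ultimately show ?thesis by simp
qed

end

section \<open>Symmetry and positivity\<close>

lemma sorted_partition_unique:
  assumes "is_partition lam" "is_partition mu" "mset lam = mset mu"
  shows "lam = mu"
proof -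
  have "sorted (rev lam)" "sorted (rev mu)"
    using assms(1,2) by (simp_all add: is_partition_def sorted_wrt_rev)
  then have "rev lam = rev mu" using assms(3) by (metis mset_rev properties_for_sort)
  then show ?thesis by simp
qed

lemma finite_partitions: "finite {lam. is_partition lam \<and> sum_list lam = m}"
proof (rule finite_subset)
  show "finite {xs. set xs \<subseteq> {..m} \<and> length xs \<le> m}" by (rule finite_lists_length_le) simp
  have "length xs \<le> sum_list xs" if "\<forall>x\<in>set xs. 0 < x" for xs :: "nat list"
    using that by (induction xs) auto
  then show "{lam. is_partition lam \<and> sum_list lam = m} \<subseteq> {xs. set xs \<subseteq> {..m} \<and> length xs \<le> m}"
    by (auto simp: is_partition_def member_le_sum_list)
qed

context
  fixes n :: nat
  assumes n2: "n \<ge> 2"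
begin

lemma cyc_dec_affine:
  assumes "cyc_dec n v"
  shows "affine_perm n v"
proof -
  obtain A where "A \<subset> {0..<n}" "v = cshift (per n A)" using assms cyc_dec_iff [OF n2, of v] by auto
  then show ?thesis using cshift_per(1) [OF n2, of A] by simp
qed

lemma finite_cyc_dec: "finite {v. cyc_dec n v}"
proof -
  have "{v. cyc_dec n v} = (\<lambda>A. cshift (per n A)) ` {A. A \<subset> {0..<n}}"
    using cyc_dec_iff [OF n2] by auto
  then show ?thesis using finite_proper_subsets [OF n2] by simp
qed

section \<open>Factorizations counted by lists of lengths\<close>

definition cyc_fact :: "(int \<Rightarrow> int) list \<Rightarrow> nat list \<Rightarrow> bool" where
  "cyc_fact vs as \<longleftrightarrow> list_all2 (\<lambda>v a. cyc_dec n v \<and> alen n v = a) vs as"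

definition fact_set :: "(int \<Rightarrow> int) \<Rightarrow> nat list \<Rightarrow> (int \<Rightarrow> int) list set" where
  "fact_set u as = {vs. cyc_fact vs as \<and> foldr (\<circ>) vs id = u}"

text \<open>\<open>affine_stanley_coeff\<close> for a list of exponents instead of an exponent
  vector, so that factors can be split off and reordered.\<close>

definition fact_count :: "(int \<Rightarrow> int) \<Rightarrow> nat list \<Rightarrow> nat" where
  "fact_count u as = (if alen n u = sum_list as then card (fact_set u as) else 0)"

lemma cyc_fact_Cons: "cyc_fact vs (a # as) \<longleftrightarrow> (\<exists>v vs'. vs = v # vs' \<and> cyc_dec n v \<and> alen n v = a \<and> cyc_fact vs' as)"
  by (auto simp: cyc_fact_def list_all2_Cons2)

lemma cyc_fact_prod:
  assumes "cyc_fact vs as"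
  shows "affine_perm n (foldr (\<circ>) vs id) \<and> alen n (foldr (\<circ>) vs id) \<le> sum_list as"
proof -
  define \<pi> :: "(int \<Rightarrow> int) list \<Rightarrow> int \<Rightarrow> int" where "\<pi> vs = foldr (\<circ>) vs id" for vs
  have \<pi>: "\<pi> [] = id" "\<pi> (v # vs) = v \<circ> \<pi> vs" for v vs by (simp_all add: \<pi>_def)
  have "affine_perm n (\<pi> vs) \<and> alen n (\<pi> vs) \<le> sum_list as"
    using assms
  proof (induction as arbitrary: vs)
    case Nil
    then have "\<pi> vs = id" by (simp add: cyc_fact_def \<pi>)
    then show ?case using affine_perm_id [OF n2] alen_id [OF n2] by (metis le0)
  next
    case (Cons a as)
    then obtain v vs' where vs: "vs = v # vs'" "cyc_dec n v" "alen n v = a" "cyc_fact vs' as"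
      by (auto simp: cyc_fact_Cons)
    note IH = Cons.IH [OF vs(4)] and v = cyc_dec_affine [OF vs(2)]
    have "affine_perm n (v \<circ> \<pi> vs')" using affine_perm_comp [OF n2 v] IH by blast
    moreover have "alen n (v \<circ> \<pi> vs') \<le> alen n v + alen n (\<pi> vs')"
      using alen_comp_le [OF n2 v] IH by blast
    ultimately show ?case unfolding vs(1) \<pi> using vs(3) IH by (simp add: comp_def)
  qed
  then show ?thesis unfolding \<pi>_def .
qed

lemma finite_cyc_fact: "finite {vs. cyc_fact vs as}"
proof (rule finite_subset)
  show "finite {vs. set vs \<subseteq> {v. cyc_dec n v} \<and> length vs = length as}"
    by (rule finite_lists_length_eq [OF finite_cyc_dec])
  show "{vs. cyc_fact vs as} \<subseteq> {vs. set vs \<subseteq> {v. cyc_dec n v} \<and> length vs = length as}"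
    by (auto simp: cyc_fact_def list_all2_conv_all_nth in_set_conv_nth)
qed

text \<open>For each first factor \<open>v\<close> the remaining factors multiply to
  \<open>inv v \<circ> u\<close>, to which the hypothesis applies.\<close>

lemma fact_count_Cons_cong:
  assumes eq: "\<And>u. fact_count u xs = fact_count u ys" and s: "sum_list xs = sum_list ys"
  shows "fact_count u (a # xs) = fact_count u (a # ys)"
proof (cases "alen n u = a + sum_list xs")
  case True
  let ?C = "{v. cyc_dec n v \<and> alen n v = a}"
  let ?S = "\<lambda>v zs. {vs. cyc_fact vs zs \<and> v \<circ> foldr (\<circ>) vs id = u}"
  have finC: "finite ?C" by (rule finite_subset [OF _ finite_cyc_dec]) auto
  have cnt: "card (fact_set u (a # zs)) = (\<Sum>v\<in>?C. card (?S v zs))" for zs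
  proof -
    have "fact_set u (a # zs) = (\<lambda>(v, vs). v # vs) ` (SIGMA v:?C. ?S v zs)"
      by (auto simp: fact_set_def cyc_fact_Cons image_iff)
    then have "card (fact_set u (a # zs)) = card (SIGMA v:?C. ?S v zs)"
      by (simp add: card_image inj_on_def)
    also have "\<dots> = (\<Sum>v\<in>?C. card (?S v zs))"
    proof (rule card_SigmaI [OF finC], rule ballI)
      fix v show "finite (?S v zs)" by (rule finite_subset [OF _ finite_cyc_fact [of zs]]) auto
    qed
    finally show ?thesis .
  qed
  have "card (?S v xs) = card (?S v ys)" if v: "v \<in> ?C" for v
  proof -
    let ?u = "inv v \<circ> u"
    have aff: "affine_perm n v" using v cyc_dec_affine by blast
    then have bij: "bij v" by (simp add: affine_perm_def)
    then have iff: "v \<circ> f = u \<longleftrightarrow> f = ?u" for f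
      by (metis bij_is_inj bij_is_surj comp_assoc id_comp inv_o_cancel surj_iff)
    have S: "?S v zs = fact_set ?u zs" for zs by (simp add: iff fact_set_def)
    show ?thesis
    proof (cases "alen n ?u = sum_list xs")
      case True
      then show ?thesis using eq [of ?u] s by (simp add: fact_count_def S)
    next
      case False
      \<comment> \<open>With the wrong length nothing factors: a product of such factors has length
        at most \<open>sum_list xs\<close>, and a shorter one would make \<open>u\<close> too
        short.\<close>
      have "fact_set ?u zs = {}" if zs: "sum_list zs = sum_list xs" for zs
      proof (rule ccontr)
        assume "fact_set ?u zs \<noteq> {}"
        then obtain vs where "cyc_fact vs zs" "foldr (\<circ>) vs id = ?u" by (auto simp: fact_set_def)
        then have "affine_perm n ?u" "alen n ?u \<le> sum_list xs" using cyc_fact_prod zs by metis+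
        moreover have "alen n (v \<circ> ?u) \<le> alen n v + alen n ?u"
          by (rule alen_comp_le [OF n2 aff]) fact
        moreover have "v \<circ> ?u = u" using iff by blast
        ultimately show False using False \<open>alen n u = a + sum_list xs\<close> v by simp
      qed
      then show ?thesis using s by (simp add: S)
    qed
  qed
  then show ?thesis using True s by (simp add: fact_count_def cnt)
qed (use s in \<open>simp add: fact_count_def\<close>)

definition pair_set :: "(int \<Rightarrow> int) \<Rightarrow> nat \<Rightarrow> nat \<Rightarrow> ((int \<Rightarrow> int) \<times> (int \<Rightarrow> int)) set" where
  "pair_set z a b = {(v, v'). cyc_dec n v \<and> alen n v = a \<and> cyc_dec n v' \<and> alen n v' = b \<and> v \<circ> v' = z}"

lemma card_pair_set:
  assumes "alen n z = a + b"
  shows "card (pair_set z a b) = card {(A, B). (A, B) \<in> factor_pairs n z \<and> card A = a \<and> card B = b}"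
proof -
  let ?c = "\<lambda>A. cshift (per n A)"
  let ?E = "{(A, B). (A, B) \<in> factor_pairs n z \<and> card A = a \<and> card B = b}"
  have "pair_set z a b = map_prod ?c ?c ` ?E"
  proof (intro set_eqI iffI)
    fix p assume "p \<in> pair_set z a b"
    then obtain v v' where p: "p = (v, v')" "cyc_dec n v" "alen n v = a" "cyc_dec n v'" "alen n v' = b" "v \<circ> v' = z"
      by (auto simp: pair_set_def)
    then obtain A B where AB: "A \<subset> {0..<n}" "v = ?c A" "B \<subset> {0..<n}" "v' = ?c B"
      using cyc_dec_iff [OF n2] by metis
    then have "card A = a" "card B = b" using p cshift_per(2) [OF n2] by auto
    then have "(A, B) \<in> ?E" using AB p assms by (simp add: factor_pairs_def [OF n2])
    then show "p \<in> map_prod ?c ?c ` ?E" using p AB by (intro image_eqI [of _ _ "(A, B)"]) auto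
  next
    fix p assume "p \<in> map_prod ?c ?c ` ?E"
    then show "p \<in> pair_set z a b"
      using cshift_per [OF n2] by (auto simp: pair_set_def factor_pairs_def [OF n2])
  qed
  moreover have "inj_on (map_prod ?c ?c) ?E"
    by (rule inj_on_subset [OF map_prod_inj_on [OF cshift_per_inj [OF n2] cshift_per_inj [OF n2]]])
      (auto simp: factor_pairs_def [OF n2])
  ultimately show ?thesis by (simp add: card_image)
qed

text \<open>Factorizations are grouped by the product \<open>z\<close> of the first two factors
  together with the remaining ones, which reduces the exchange to
  \<open>card_factor_pairs_swap\<close>.\<close>

lemma fact_count_swap: "fact_count u (a # b # zs) = fact_count u (b # a # zs)"
proof (cases "alen n u = a + b + sum_list zs")
  case True
  let ?C = "{v. cyc_dec n v}"
  let ?Z = "(\<lambda>(v, v'). v \<circ> v') ` (?C \<times> ?C)"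
  let ?P = "{(z, vs). z \<in> ?Z \<and> cyc_fact vs zs \<and> z \<circ> foldr (\<circ>) vs id = u}"
  have finP: "finite ?P"
    by (rule finite_subset [of _ "?Z \<times> {vs. cyc_fact vs zs}"]) (auto simp: finite_cyc_fact finite_cyc_dec)
  have cnt: "card (fact_set u (c # d # zs)) = (\<Sum>(z, vs)\<in>?P. card (pair_set z c d))" for c d
  proof -
    have "fact_set u (c # d # zs) = (\<lambda>((z, vs), (v, v')). v # v' # vs) ` (SIGMA p:?P. pair_set (fst p) c d)"
      (is "?L = ?f ` ?R")
    proof (intro set_eqI iffI)
      fix l assume "l \<in> ?L"
      then obtain v v' vs where l: "l = v # v' # vs" "cyc_dec n v" "alen n v = c" "cyc_dec n v'" "alen n v' = d"
          "cyc_fact vs zs" "v \<circ> (v' \<circ> foldr (\<circ>) vs id) = u"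
        by (auto simp: fact_set_def cyc_fact_Cons)
      have "((v \<circ> v', vs), (v, v')) \<in> ?R" using l by (auto simp: pair_set_def comp_assoc)
      then show "l \<in> ?f ` ?R" using l(1) by (intro image_eqI [of _ _ "((v \<circ> v', vs), (v, v'))"]) auto
    next
      fix l assume "l \<in> ?f ` ?R"
      then obtain r where r: "r \<in> ?R" "l = ?f r" by blast
      obtain z vs v v' where "r = ((z, vs), (v, v'))" by (metis surj_pair)
      with r have l: "l = v # v' # vs" "(z, vs) \<in> ?P" "(v, v') \<in> pair_set z c d" by simp_all
      then have "v \<circ> (v' \<circ> foldr (\<circ>) vs id) = u" by (auto simp: pair_set_def comp_assoc [symmetric])
      then show "l \<in> ?L" using l by (auto simp: fact_set_def cyc_fact_Cons pair_set_def)
    qed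
    moreover have "inj_on ?f ?R" by (auto simp: inj_on_def pair_set_def)
    ultimately have "card ?L = card ?R" by (simp add: card_image)
    also have "\<dots> = (\<Sum>p\<in>?P. card (pair_set (fst p) c d))"
    proof (rule card_SigmaI [OF finP], rule ballI)
      fix p show "finite (pair_set (fst p) c d)"
        by (rule finite_subset [of _ "?C \<times> ?C"]) (auto simp: pair_set_def finite_cyc_dec)
    qed
    finally show ?thesis by (simp add: case_prod_unfold)
  qed
  have "card (pair_set z a b) = card (pair_set z b a)" if p: "(z, vs) \<in> ?P" for z vs
  proof -
    have z: "affine_perm n z" using p affine_perm_comp [OF n2] cyc_dec_affine by auto
    show ?thesis
    proof (cases "alen n z = a + b")
      case True
      then show ?thesis
        using card_factor_pairs_swap [OF n2 z, of a b] by (simp add: card_pair_set)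
    next
      case False
      \<comment> \<open>A shorter \<open>z\<close> would make \<open>u\<close> too short, and a
        longer one is no product of elements of lengths \<open>a\<close> and
        \<open>b\<close>.\<close>
      have "alen n u \<le> alen n z + alen n (foldr (\<circ>) vs id)"
        using p alen_comp_le [OF n2 z] cyc_fact_prod by auto
      then have "alen n z > a + b" using False True p cyc_fact_prod [of vs zs] by simp
      then have "pair_set z c d = {}" if "c + d = a + b" for c d
        using that alen_comp_le [OF n2] cyc_dec_affine by (force simp: pair_set_def)
      then show ?thesis by (simp add: add.commute)
    qed
  qed
  then have "(\<Sum>(z, vs)\<in>?P. card (pair_set z a b)) = (\<Sum>(z, vs)\<in>?P. card (pair_set z b a))"
    by (intro sum.cong) auto
  then show ?thesis using True by (simp add: fact_count_def cnt add.commute add.left_commute)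
qed (simp add: fact_count_def ac_simps)

text \<open>Exchanging the first two entries suffices: induction on the tail brings the head of
  \<open>ys\<close> to second place in \<open>xs\<close>, one exchange puts it first, and induction
  then compares the tails.\<close>

lemma fact_count_perm: "mset xs = mset ys \<Longrightarrow> fact_count u xs = fact_count u ys"
proof (induction xs arbitrary: ys u rule: length_induct)
  case (1 xs)
  show ?case
  proof (cases xs)
    case Nil
    then show ?thesis using 1 by simp
  next
    case (Cons a xs')
    then obtain b ys' where ys: "ys = b # ys'" using 1 by (cases ys) auto
    have IH: "fact_count u us = fact_count u vs" if "mset us = mset vs" "length us < length xs" for u us vs
      using 1(1) that by blast
    have len: "length ys = length xs" using "1.prems" by (metis size_mset)
    show ?thesis
    proof (cases "a = b")
      case True
      then have "mset xs' = mset ys'" using 1 Cons ys by simp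
      then show ?thesis
        unfolding Cons ys True using IH Cons
        by (intro fact_count_Cons_cong) (auto simp: sum_mset_sum_list [symmetric])
    next
      case False
      then have b: "b \<in># mset xs'" using 1 Cons ys
        by (metis insert_noteq_member mset.simps(2))
      define zs where "zs = remove1 b xs'"
      have xs': "mset xs' = mset (b # zs)" using b by (simp add: zs_def)
      have ys': "mset ys' = mset (a # zs)"
        using "1.prems" xs' by (simp add: Cons ys add_mset_commute)
      have "fact_count u (a # xs') = fact_count u (a # b # zs)"
        using xs' IH Cons by (intro fact_count_Cons_cong) (auto simp: sum_mset_sum_list [symmetric] simp del: mset.simps)
      also have "\<dots> = fact_count u (b # a # zs)" by (rule fact_count_swap)
      also have "\<dots> = fact_count u (b # ys')"
        using ys' IH len ys by (intro fact_count_Cons_cong) (auto simp: sum_mset_sum_list [symmetric] simp del: mset.simps)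
      finally show ?thesis by (simp add: Cons ys)
    qed
  qed
qed

lemma fact_count_0: "fact_count u (0 # xs) = fact_count u xs"
proof -
  have id: "cyc_dec n id" "alen n id = 0"
    using cshift_per(3) [OF n2, of "{}"] n2 alen_id [OF n2] by (simp_all add: per_def cshift_empty psubset_eq)
  have "fact_set u (0 # xs) = (#) id ` fact_set u xs"
  proof (intro set_eqI iffI)
    fix l assume "l \<in> fact_set u (0 # xs)"
    then obtain v vs where l: "l = v # vs" "cyc_dec n v" "alen n v = 0" "cyc_fact vs xs" "v \<circ> foldr (\<circ>) vs id = u"
      by (auto simp: fact_set_def cyc_fact_Cons)
    then have "v = id" using alen_0_imp_id [OF n2] cyc_dec_affine by blast
    then show "l \<in> (#) id ` fact_set u xs" using l by (auto simp: fact_set_def)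
  qed (auto simp: fact_set_def cyc_fact_Cons id)
  then have "card (fact_set u (0 # xs)) = card (fact_set u xs)" by (simp add: card_image)
  then show ?thesis by (simp add: fact_count_def)
qed

lemma fact_count_filter: "fact_count u (filter (\<lambda>a. a \<noteq> 0) xs) = fact_count u xs"
proof (induction xs arbitrary: u)
  case (Cons a xs)
  have "sum_list (filter (\<lambda>a. a \<noteq> 0) xs) = sum_list xs" by (induction xs) auto
  then show ?case using Cons fact_count_0 [of u xs] fact_count_Cons_cong [of "filter (\<lambda>a. a \<noteq> 0) xs" xs u a]
    by (cases "a = 0") auto
qed simp

text \<open>This is the symmetry of \<open>F_u\<close>: the list may hold the nonzero exponents in
  any order. Zero exponents below \<open>ybound\<close> stand for trivial factors.\<close>

lemma affine_stanley_coeff_eq: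
  assumes lam: "mset lam = image_mset (Poly_Mapping.lookup \<alpha>) (mset_set (Poly_Mapping.keys \<alpha>))"
  shows "affine_stanley_coeff n u \<alpha> = fact_count u lam"
proof -
  let ?N = "ybound \<alpha>" and ?f = "Poly_Mapping.lookup \<alpha>"
  let ?xs = "map ?f [0..<?N]"
  have sum: "(\<Sum>i<?N. ?f i) = sum_list ?xs"
    by (simp add: interv_sum_list_conv_sum_set_nat atLeast0LessThan)
  have "{vs. length vs = ?N \<and> (\<forall>i<?N. cyc_dec n (vs ! i) \<and> alen n (vs ! i) = ?f i) \<and>
      foldr (\<circ>) vs id = u \<and> alen n u = (\<Sum>i<?N. ?f i)} = (if alen n u = sum_list ?xs then fact_set u ?xs else {})"
    unfolding sum by (auto simp: fact_set_def cyc_fact_def list_all2_conv_all_nth)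
  then have "affine_stanley_coeff n u \<alpha> = fact_count u ?xs"
    by (simp add: affine_stanley_coeff_def fact_count_def)
  also have "\<dots> = fact_count u (filter (\<lambda>a. a \<noteq> 0) ?xs)" by (simp only: fact_count_filter)
  also have "\<dots> = fact_count u lam"
  proof (rule fact_count_perm)
    have "Poly_Mapping.keys \<alpha> \<subseteq> {0..<?N}"
      by (auto simp: ybound_def less_Suc_eq_le)
    then have "{i \<in> {0..<?N}. ?f i \<noteq> 0} = Poly_Mapping.keys \<alpha>" by (auto simp: in_keys_iff)
    then show "mset (filter (\<lambda>a. a \<noteq> 0) ?xs) = mset lam"
      unfolding lam by (simp add: mset_filter filter_mset_image_mset)
  qed
  finally show ?thesis .
qed

text \<open>Neither factor is longer than \<open>w\<close>, and words of bounded length over a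
  finite alphabet are finite in number. This bounds the support of the final coefficients.\<close>

lemma finite_length_additive_pairs:
  "finite {(u, v). affine_perm n u \<and> fin_perm n v \<and> w = u \<circ> v \<and> alen n w = alen n u + alen n v}"
proof -
  let ?G = "word_prod n ` {ws. set ws \<subseteq> {0..<n} \<and> length ws \<le> alen n w}"
  have "finite ?G" by (intro finite_imageI finite_lists_length_le) simp
  moreover have "u \<in> ?G" if "affine_perm n u" "alen n u \<le> alen n w" for u
    using ex_reduced_word [OF n2 that(1)] that alen_eq_ainv [OF n2 that(1)] by auto
  then have "{(u, v). affine_perm n u \<and> fin_perm n v \<and> w = u \<circ> v \<and> alen n w = alen n u + alen n v} \<subseteq> ?G \<times> ?G"
    by (auto simp: fin_perm_def)
  ultimately show ?thesis by (meson finite_SigmaI finite_subset)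
qed

end

theorem theorem6p1:
  fixes n :: nat and w :: "int \<Rightarrow> int"
  assumes "n \<ge> 2" and "affine_perm n w"
  shows "\<exists>c :: nat list \<times> (nat \<Rightarrow>\<^sub>0 nat) \<Rightarrow> nat.
           finite {p. c p \<noteq> 0} \<and> (\<forall>p. c p \<noteq> 0 \<longrightarrow> is_partition (fst p)) \<and>
           (\<forall>\<alpha> a. aff_schub_coeff n w \<alpha> a =
              (\<Sum>p\<in>{p. c p \<noteq> 0}. int (c p) * mono_sym (fst p) \<alpha> * (if snd p = a then 1 else 0)))"
proof -
  note n2 = assms(1)
  let ?D = "{(u, v). affine_perm n u \<and> fin_perm n v \<and> w = u \<circ> v \<and> alen n w = alen n u + alen n v}"
  have finD: "finite ?D" by (rule finite_length_additive_pairs [OF n2])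
  define s where "s lam a = (\<Sum>(u, v)\<in>?D. int (fact_count n u lam) * Poly_Mapping.lookup (schub n v) a)" for lam a
  \<comment> \<open>\<open>nat\<close> loses nothing because \<open>s_nonneg\<close> holds; the
    value 0 off partitions gives the support that the statement demands.\<close>
  define c where "c p = (if is_partition (fst p) then nat (s (fst p) (snd p)) else 0)" for p
  have s_nonneg: "s lam a \<ge> 0" for lam a
    unfolding s_def by (intro sum_nonneg) (auto simp: schub_nonneg [OF n2])
  have c: "int (c (lam, a)) = s lam a" if "is_partition lam" for lam a
    using that s_nonneg by (simp add: c_def)
  have fin: "finite {p. c p \<noteq> 0}"
  proof (rule finite_subset)
    show "finite (\<Union>(u, v)\<in>?D. {lam. is_partition lam \<and> sum_list lam = alen n u} \<times> Poly_Mapping.keys (schub n v))"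
      using finD finite_partitions by auto
    show "{p. c p \<noteq> 0} \<subseteq> (\<Union>(u, v)\<in>?D. {lam. is_partition lam \<and> sum_list lam = alen n u} \<times> Poly_Mapping.keys (schub n v))"
    proof
      fix p assume "p \<in> {p. c p \<noteq> 0}"
      then have p: "is_partition (fst p)" "s (fst p) (snd p) \<noteq> 0" by (auto simp: c_def split: if_splits)
      then obtain u v where uv: "(u, v) \<in> ?D" "int (fact_count n u (fst p)) * Poly_Mapping.lookup (schub n v) (snd p) \<noteq> 0"
        unfolding s_def by (auto elim!: sum.not_neutral_contains_not_neutral)
      then have "sum_list (fst p) = alen n u" by (auto simp: fact_count_def [OF n2] split: if_splits)
      moreover have "snd p \<in> Poly_Mapping.keys (schub n v)" using uv(2) by (auto simp: in_keys_iff)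
      ultimately have "p \<in> {lam. is_partition lam \<and> sum_list lam = alen n u} \<times> Poly_Mapping.keys (schub n v)"
        using p(1) by (auto simp: mem_Times_iff)
      then show "p \<in> (\<Union>(u, v)\<in>?D. {lam. is_partition lam \<and> sum_list lam = alen n u} \<times> Poly_Mapping.keys (schub n v))"
        using uv(1) by blast
    qed
  qed
  have eq: "aff_schub_coeff n w \<alpha> a =
      (\<Sum>p\<in>{p. c p \<noteq> 0}. int (c p) * mono_sym (fst p) \<alpha> * (if snd p = a then 1 else 0))" for \<alpha> a
  proof -
    let ?M = "image_mset (Poly_Mapping.lookup \<alpha>) (mset_set (Poly_Mapping.keys \<alpha>))"
    \<comment> \<open>The sorted nonzero exponents of \<open>\<alpha>\<close> form the only
      partition whose monomial symmetric function contains this monomial, so a single term of the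
      sum survives.\<close>
    define lam where "lam = rev (sorted_list_of_multiset ?M)"
    have mset: "mset lam = ?M" by (simp add: lam_def)
    have "set lam = Poly_Mapping.lookup \<alpha> ` Poly_Mapping.keys \<alpha>"
      using arg_cong [OF mset, of set_mset] by simp
    then have "\<forall>x\<in>set lam. 0 < x" by (auto simp: in_keys_iff)
    then have part: "is_partition lam"
      by (simp add: is_partition_def lam_def sorted_wrt_rev)
    have m: "mono_sym mu \<alpha> = (if mu = lam then 1 else 0)" for mu
      unfolding mono_sym_def mset [symmetric] using sorted_partition_unique [of mu lam] part by auto
    have "aff_schub_coeff n w \<alpha> a = s lam a"
      unfolding aff_schub_coeff_def s_def affine_stanley_coeff_eq [OF n2 mset] ..
    also have "\<dots> = int (c (lam, a))" using c [OF part] by simp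
    also have "\<dots> = (\<Sum>p\<in>{p. c p \<noteq> 0}. if p = (lam, a) then int (c p) else 0)"
      using fin by (simp add: sum.delta')
    also have "\<dots> = (\<Sum>p\<in>{p. c p \<noteq> 0}. int (c p) * mono_sym (fst p) \<alpha> * (if snd p = a then 1 else 0))"
      by (rule sum.cong) (auto simp: m prod_eq_iff)
    finally show ?thesis .
  qed
  have "\<forall>p. c p \<noteq> 0 \<longrightarrow> is_partition (fst p)" by (simp add: c_def)
  with fin eq show ?thesis by blast
qed

end
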